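(* Consider $\min_{x\in\mathbb{R}^d} f(x)=\frac1n\sum_{i=1}^n f_i(x)$, where each $f_i$ is convex and $L$-smooth and is supported on the coordinate set $T_i\subseteq\{1,\dots,d\}$, and $f$ satisfies the quadratic growth condition $f(x)-f(x^\star)\ge\frac{\mu}{2}\|x-x^\star\|^2$ for all $x\in\mathbb{R}^d$ with $\mu>0$ (in particular, this holds if $f$ is $\mu$-strongly convex), where $x^\star$ is the minimizer of $f$. Let $\kappa=L/\mu$. For any constant $\omega>1$, let $m=\Theta(n)$ and $$\vartheta=\frac{\sqrt m}{\sqrt\kappa+\sqrt m},\qquad \varphi=\frac{1-\vartheta}{L},\qquad \eta=\frac{1-\vartheta}{L\vartheta},\qquad S=\left\lceil 2\omega\sqrt{\frac{\kappa}{m}}\right\rceil .$$ For any accuracy $\epsilon>0$ and any initial point $x_0\in\mathbb{R}^d$, there is a number of restart rounds $R=O\big(\log\frac{f(x_0)-f(x^\star)}{\epsilon}\big)$ such that the algorithm SS-Acc-SVRG (defined in the context), run with these parameters from $x_0$, outputs $x_R$ satisfying $\mathbb{E}[f(x_R)]-f(x^\star)\le\epsilon$, with oracle complexity $$O\left(\max\left\{n,\sqrt{\kappa n}\right\}\log\frac{f(x_0)-f(x^\star)}{\epsilon}\right).$$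
   Context: Setting. $\|\cdot\|$ and $\langle\cdot,\cdot\rangle$ are the Euclidean norm and inner product. A function $g$ is $L$-smooth if $\|\nabla g(x)-\nabla g(y)\|\le L\|x-y\|$ for all $x,y$. "$f_i$ is supported on $T_i$" means that $f_i(x)$ depends only on the coordinates of $x$ in $T_i$ (so $\nabla f_i$ depends only on these coordinates and vanishes outside $T_i$). Every coordinate $v\in\{1,\dots,d\}$ belongs to at least one $T_i$. $P_i\in\mathbb{R}^{d\times d}$ is the diagonal projection matrix onto the coordinates in $T_i$, $D=\big(\frac1n\sum_{i=1}^nP_i\big)^{-1}$ and $D_i=P_iD$. Algorithm SS-Acc-SVRG (Serial Sparse Accelerated SVRG), with input $x_0$ and parameters $m,\vartheta,\varphi,\eta,S,R$. For $r=0,\dots,R-1$: (1) set $\tilde x_0=z_0^0=x_r$; (2) for $s=0,\dots,S-1$: compute $\nabla f(\tilde x_s)$; for $k=0,\dots,m-1$, sample $i_k$ uniformly from $\{1,\dots,n\}$ (independently of the past), set $$y_k=\vartheta z_k^s+(1-\vartheta)\tilde x_s-\varphi D\nabla f(\tilde x_s),\qquad z_{k+1}^s=z_k^s-\eta\big(\nabla f_{i_k}(y_k)-\nabla f_{i_k}(\tilde x_s)+D_{i_k}\nabla f(\tilde x_s)\big)$$ (in an iteration only the coordinates in $T_{i_k}$ need to be computed and updated; the other coordinates of $z^s$ are unchanged); then set $\tilde x_{s+1}=y_t$ for $t$ uniformly random in $\{0,\dots,m-1\}$ and $z_0^{s+1}=z_m^s$; (3) set $x_{r+1}=\frac1S\sum_{s=0}^{S-1}\tilde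 x_{s+1}$. The output is $x_R$. Oracle complexity is the number of incremental gradient computations (evaluations of some $\nabla f_i$ at a point) performed; for this algorithm it is counted as $R\cdot S\cdot(n+2m)$. $\mathbb{E}$ is total expectation. The constants hidden in $O(\cdot)$ may depend on $\omega$ and on the constants in $m=\Theta(n)$ only; a logarithmic factor inside $O(\cdot)$ is understood, as usual, as being at least a positive constant. *)

theory Defs
  imports
    "HOL-Probability.Probability_Mass_Function"
    "Jordan_Normal_Form.Gauss_Jordan_Elimination"
begin

no_notation inner (infix "\<bullet>" 70)
no_notation Finite_Cartesian_Product.vec_nth (infixl "$" 90)
hide_type (open) Finite_Cartesian_Product.vec
hide_const (open) Finite_Cartesian_Product.vec Finite_Cartesian_Product.mat

section \<open>Functions on Euclidean space of dimension d\<close>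

text \<open>
  The constants hidden in an asymptotic bound must not depend on the dimension, so the dimension
  is quantified inside the formula. Hence it is a natural number here and not a type:
  points of d-dimensional space are the elements of \<open>carrier_vec d\<close>, with coordinates \<open>0, \<dots>, d - 1\<close>.
  The type \<open>real vec\<close> is not a normed space, so the analytic notions are spelled out relative
  to \<open>carrier_vec d\<close>. Values of a function outside \<open>carrier_vec d\<close> never matter.
\<close>

definition enorm :: "real vec \<Rightarrow> real" where
  "enorm x = sqrt (x \<bullet> x)"

text \<open>Frechet differentiability at \<open>x\<close>, the derivative being the inner product with \<open>g\<close>.\<close>

definition has_gradient :: "nat \<Rightarrow> (real vec \<Rightarrow> real) \<Rightarrow> real vec \<Rightarrow> real vec \<Rightarrow> bool" where
  "has_gradient d f g x \<longleftrightarrow> g \<in> carrier_vec d \<and>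
     (\<forall>e>0. \<exists>\<delta>>0. \<forall>y\<in>carrier_vec d. enorm (y - x) < \<delta> \<longrightarrow>
        \<bar>f y - f x - g \<bullet> (y - x)\<bar> \<le> e * enorm (y - x))"

definition grad :: "nat \<Rightarrow> (real vec \<Rightarrow> real) \<Rightarrow> real vec \<Rightarrow> real vec" where
  "grad d f x = (THE g. has_gradient d f g x)"

definition smooth_fun :: "nat \<Rightarrow> real \<Rightarrow> (real vec \<Rightarrow> real) \<Rightarrow> bool" where
  "smooth_fun d L f \<longleftrightarrow>
     (\<forall>x\<in>carrier_vec d. \<exists>g. has_gradient d f g x) \<and>
     (\<forall>x\<in>carrier_vec d. \<forall>y\<in>carrier_vec d.
        enorm (grad d f x - grad d f y) \<le> L * enorm (x - y))"

definition convex_fun :: "nat \<Rightarrow> (real vec \<Rightarrow> real) \<Rightarrow> bool" where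
  "convex_fun d f \<longleftrightarrow>
     (\<forall>x\<in>carrier_vec d. \<forall>y\<in>carrier_vec d. \<forall>u\<ge>0. \<forall>v\<ge>0. u + v = 1 \<longrightarrow>
        f (u \<cdot>\<^sub>v x + v \<cdot>\<^sub>v y) \<le> u * f x + v * f y)"

definition supported_on :: "nat \<Rightarrow> nat set \<Rightarrow> (real vec \<Rightarrow> real) \<Rightarrow> bool" where
  "supported_on d T f \<longleftrightarrow>
     (\<forall>x\<in>carrier_vec d. \<forall>y\<in>carrier_vec d. (\<forall>j\<in>T. x $ j = y $ j) \<longrightarrow> f x = f y)"

definition quadratic_growth :: "nat \<Rightarrow> real \<Rightarrow> (real vec \<Rightarrow> real) \<Rightarrow> real vec \<Rightarrow> bool" where
  "quadratic_growth d \<mu> f xstar \<longleftrightarrow>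
     (\<forall>x\<in>carrier_vec d. f x - f xstar \<ge> \<mu> / 2 * (enorm (x - xstar))\<^sup>2)"

definition is_minimizer :: "nat \<Rightarrow> (real vec \<Rightarrow> real) \<Rightarrow> real vec \<Rightarrow> bool" where
  "is_minimizer d f xstar \<longleftrightarrow>
     xstar \<in> carrier_vec d \<and> (\<forall>x\<in>carrier_vec d. f xstar \<le> f x)"

section \<open>The finite-sum problem\<close>

definition avg_fun :: "nat \<Rightarrow> (nat \<Rightarrow> real vec \<Rightarrow> real) \<Rightarrow> real vec \<Rightarrow> real" where
  "avg_fun n F x = (\<Sum>i<n. F i x) / real n"

definition proj_mat :: "nat \<Rightarrow> nat set \<Rightarrow> real mat" where
  "proj_mat d T = mat d d (\<lambda>(a, b). if a = b \<and> a \<in> T then 1 else 0)"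

definition avg_proj_mat :: "nat \<Rightarrow> nat \<Rightarrow> (nat \<Rightarrow> nat set) \<Rightarrow> real mat" where
  "avg_proj_mat d n T = mat d d (\<lambda>ab. (\<Sum>i<n. proj_mat d (T i) $$ ab) / real n)"

text \<open>
  \<open>D_mat\<close> is only used when every coordinate lies in some \<open>T i\<close>; the averaged projection is
  then invertible and \<open>mat_inverse\<close> is not \<open>None\<close>.
\<close>

definition D_mat :: "nat \<Rightarrow> nat \<Rightarrow> (nat \<Rightarrow> nat set) \<Rightarrow> real mat" where
  "D_mat d n T = the (mat_inverse (avg_proj_mat d n T))"

definition Di_mat :: "nat \<Rightarrow> nat \<Rightarrow> (nat \<Rightarrow> nat set) \<Rightarrow> nat \<Rightarrow> real mat" where
  "Di_mat d n T i = proj_mat d (T i) * D_mat d n T"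

section \<open>Serial Sparse Accelerated SVRG\<close>

text \<open>
  The algorithm is a probabilistic program. In the arguments below \<open>\<theta>\<close>, \<open>\<phi>\<close>, \<open>\<eta>\<close> are the
  coupling parameter and the two step sizes, \<open>xt\<close> is the current snapshot and \<open>z\<close> the current
  value of the z-sequence.
\<close>

definition y_point ::
  "nat \<Rightarrow> nat \<Rightarrow> (nat \<Rightarrow> real vec \<Rightarrow> real) \<Rightarrow> (nat \<Rightarrow> nat set) \<Rightarrow> real \<Rightarrow> real \<Rightarrow>
   real vec \<Rightarrow> real vec \<Rightarrow> real vec" where
  "y_point d n F T \<theta> \<phi> xt z =
     \<theta> \<cdot>\<^sub>v z + (1 - \<theta>) \<cdot>\<^sub>v xt - \<phi> \<cdot>\<^sub>v (D_mat d n T *\<^sub>v grad d (avg_fun n F) xt)"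

definition grad_estimator ::
  "nat \<Rightarrow> nat \<Rightarrow> (nat \<Rightarrow> real vec \<Rightarrow> real) \<Rightarrow> (nat \<Rightarrow> nat set) \<Rightarrow>
   real vec \<Rightarrow> real vec \<Rightarrow> nat \<Rightarrow> real vec" where
  "grad_estimator d n F T xt y i =
     grad d (F i) y - grad d (F i) xt + Di_mat d n T i *\<^sub>v grad d (avg_fun n F) xt"

text \<open>After \<open>k\<close> inner iterations: the iterate \<open>z\<^sub>k\<close> and the list \<open>[y\<^sub>0, \<dots>, y\<^sub>k\<^sub>-\<^sub>1]\<close>.\<close>

primrec inner_loop ::
  "nat \<Rightarrow> nat \<Rightarrow> (nat \<Rightarrow> real vec \<Rightarrow> real) \<Rightarrow> (nat \<Rightarrow> nat set) \<Rightarrow> real \<Rightarrow> real \<Rightarrow> real \<Rightarrow>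
   real vec \<Rightarrow> real vec \<Rightarrow> nat \<Rightarrow> (real vec \<times> real vec list) pmf" where
  "inner_loop d n F T \<theta> \<phi> \<eta> xt z0 0 = return_pmf (z0, [])"
| "inner_loop d n F T \<theta> \<phi> \<eta> xt z0 (Suc k) = do {
     (z, ys) \<leftarrow> inner_loop d n F T \<theta> \<phi> \<eta> xt z0 k;
     i \<leftarrow> pmf_of_set {..<n};
     let y = y_point d n F T \<theta> \<phi> xt z;
     return_pmf (z - \<eta> \<cdot>\<^sub>v grad_estimator d n F T xt y i, ys @ [y])
   }"

text \<open>One epoch returns the next snapshot and the next start of the z-sequence.\<close>

definition epoch ::
  "nat \<Rightarrow> nat \<Rightarrow> (nat \<Rightarrow> real vec \<Rightarrow> real) \<Rightarrow> (nat \<Rightarrow> nat set) \<Rightarrow> nat \<Rightarrow> real \<Rightarrow> real \<Rightarrow> real \<Rightarrow>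
   real vec \<Rightarrow> real vec \<Rightarrow> (real vec \<times> real vec) pmf" where
  "epoch d n F T m \<theta> \<phi> \<eta> xt z0 = do {
     (z, ys) \<leftarrow> inner_loop d n F T \<theta> \<phi> \<eta> xt z0 m;
     t \<leftarrow> pmf_of_set {..<m};
     return_pmf (ys ! t, z)
   }"

text \<open>After \<open>s\<close> epochs: snapshot, start of the z-sequence, and sum of the snapshots \<open>1, \<dots>, s\<close>.\<close>

primrec epochs ::
  "nat \<Rightarrow> nat \<Rightarrow> (nat \<Rightarrow> real vec \<Rightarrow> real) \<Rightarrow> (nat \<Rightarrow> nat set) \<Rightarrow> nat \<Rightarrow> real \<Rightarrow> real \<Rightarrow> real \<Rightarrow>
   real vec \<Rightarrow> nat \<Rightarrow> (real vec \<times> real vec \<times> real vec) pmf" where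
  "epochs d n F T m \<theta> \<phi> \<eta> x 0 = return_pmf (x, x, 0\<^sub>v d)"
| "epochs d n F T m \<theta> \<phi> \<eta> x (Suc s) = do {
     (xt, z, a) \<leftarrow> epochs d n F T m \<theta> \<phi> \<eta> x s;
     (xt', z') \<leftarrow> epoch d n F T m \<theta> \<phi> \<eta> xt z;
     return_pmf (xt', z', a + xt')
   }"

definition restart_round ::
  "nat \<Rightarrow> nat \<Rightarrow> (nat \<Rightarrow> real vec \<Rightarrow> real) \<Rightarrow> (nat \<Rightarrow> nat set) \<Rightarrow> nat \<Rightarrow> real \<Rightarrow> real \<Rightarrow> real \<Rightarrow>
   nat \<Rightarrow> real vec \<Rightarrow> real vec pmf" where
  "restart_round d n F T m \<theta> \<phi> \<eta> S x = do {
     (xt, z, a) \<leftarrow> epochs d n F T m \<theta> \<phi> \<eta> x S;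
     return_pmf ((1 / real S) \<cdot>\<^sub>v a)
   }"

primrec ss_acc_svrg ::
  "nat \<Rightarrow> nat \<Rightarrow> (nat \<Rightarrow> real vec \<Rightarrow> real) \<Rightarrow> (nat \<Rightarrow> nat set) \<Rightarrow> nat \<Rightarrow> real \<Rightarrow> real \<Rightarrow> real \<Rightarrow>
   nat \<Rightarrow> real vec \<Rightarrow> nat \<Rightarrow> real vec pmf" where
  "ss_acc_svrg d n F T m \<theta> \<phi> \<eta> S x0 0 = return_pmf x0"
| "ss_acc_svrg d n F T m \<theta> \<phi> \<eta> S x0 (Suc r) = do {
     x \<leftarrow> ss_acc_svrg d n F T m \<theta> \<phi> \<eta> S x0 r;
     restart_round d n F T m \<theta> \<phi> \<eta> S x
   }"

text \<open>
  Each epoch evaluates one full gradient (\<open>n\<close> incremental gradients) and two incremental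
  gradients per inner iteration.
\<close>

definition oracle_complexity :: "nat \<Rightarrow> nat \<Rightarrow> nat \<Rightarrow> nat \<Rightarrow> nat" where
  "oracle_complexity n m S R = R * S * (n + 2 * m)"

text \<open>
  The factor \<open>log (gap / \<epsilon>)\<close> of the bounds, kept at least 1. For \<open>gap = 0\<close> the value is 1.
\<close>

definition log_factor :: "real \<Rightarrow> real \<Rightarrow> real" where
  "log_factor gap \<epsilon> = max 1 (ln (gap / \<epsilon>))"

end

theory Submission
  imports Defs
begin

text \<open>
  In one inner iteration, expand the squared distance of \<open>z\<close> to the minimizer. The estimator is
  unbiased, and by sparsity its second moment is
  \<open>E |\<nabla>f\<^sub>i(y) - \<nabla>f\<^sub>i(xt)|\<^sup>2 + 2 \<langle>\<nabla>f(y), D \<nabla>f(xt)\<rangle> - \<langle>\<nabla>f(xt), D \<nabla>f(xt)\<rangle>\<close>. With the given step sizes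
  the first term is absorbed by cocoercivity of the gradients and the second one by the correction
  \<open>- \<phi> D \<nabla>f(xt)\<close> in \<open>y\<close>; the third one has a favourable sign. What remains telescopes over an epoch
  and over the epochs of a round, where convexity handles the averaged snapshot. Quadratic growth
  bounds the initial squared distance by the gap, so a round divides the expected gap by
  \<open>S / (2 \<surd>(\<kappa> / m)) \<ge> \<omega>\<close>.
\<close>

text \<open>Quadratic growth is used only at the start of a round, where the z-sequence starts at
  the snapshot and its squared distance is therefore bounded by the gap. Inside a round no such link
  is available, so the epochs alone give only a decay like 1 / S of the averaged gap; restarting
  turns this into a geometric rate. Although \<open>D\<close> distorts the estimator, the potential
  uses the plain Euclidean norm and no constant depends on \<open>D\<close>: \<langle>\<nabla>f(y),
  D \<nabla>f(xt)\<rangle> arises from the second moment and from the correction in \<open>y\<close>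
  with opposite signs, and \<phi> = \<eta> \<theta> makes the two cancel exactly. Positivity of
  \<open>L\<close> is not a hypothesis of the theorem.\<close>

section \<open>Inner product and Euclidean norm in coordinates\<close>

lemma scalar_prod_sum: "y \<in> carrier_vec d \<Longrightarrow> x \<bullet> y = (\<Sum>j<d. x $ j * y $ j)"
  by (simp add: scalar_prod_def atLeast0LessThan)

lemma scalar_prod_self_nonneg: "0 \<le> x \<bullet> (x :: real vec)"
  by (simp add: scalar_prod_def sum_nonneg)

lemma enorm_nonneg: "0 \<le> enorm x"
  by (simp add: enorm_def scalar_prod_self_nonneg)

lemma enorm_square: "(enorm x)\<^sup>2 = x \<bullet> x"
  by (simp add: enorm_def scalar_prod_self_nonneg)

lemma enorm_square_sum: "x \<in> carrier_vec d \<Longrightarrow> (enorm x)\<^sup>2 = (\<Sum>j<d. (x $ j)\<^sup>2)"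
  by (simp only: enorm_square scalar_prod_sum) (simp add: power2_eq_square)

lemma enorm_smult: "enorm (t \<cdot>\<^sub>v x) = \<bar>t\<bar> * enorm x"
proof -
  have "(t \<cdot>\<^sub>v x) \<bullet> (t \<cdot>\<^sub>v x) = t\<^sup>2 * (x \<bullet> x)"
    by (simp add: power2_eq_square)
  then show ?thesis by (simp add: enorm_def real_sqrt_mult)
qed

lemma enorm_uminus: "enorm (- x) = enorm x"
  by (simp add: enorm_def scalar_prod_def)

lemma scalar_prod_le_enorm:
  assumes "x \<in> carrier_vec d" "y \<in> carrier_vec d"
  shows "x \<bullet> y \<le> enorm x * enorm y"
proof (rule power2_le_imp_le)
  have "(\<Sum>j<d. x $ j * y $ j)\<^sup>2 \<le> (\<Sum>j<d. (x $ j)\<^sup>2) * (\<Sum>j<d. (y $ j)\<^sup>2)"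
    by (rule Cauchy_Schwarz_ineq_sum)
  then show "(x \<bullet> y)\<^sup>2 \<le> (enorm x * enorm y)\<^sup>2"
    using assms by (simp add: power_mult_distrib enorm_square_sum scalar_prod_sum)
qed (simp add: enorm_nonneg)

section \<open>Gradients\<close>

text \<open>The bridge to one-variable calculus: uniqueness, support, convexity and smoothness of
  gradients are all obtained by restricting the function to a line.\<close>

lemma has_gradient_line:
  assumes g: "has_gradient d f g (x + t \<cdot>\<^sub>v h)"
    and x: "x \<in> carrier_vec d" and h: "h \<in> carrier_vec d"
  shows "((\<lambda>t. f (x + t \<cdot>\<^sub>v h)) has_real_derivative (g \<bullet> h)) (at t)"
  unfolding DERIV_def LIM_eq
proof (intro allI impI)
  fix r :: real assume r: "r > 0"
  \<comment> \<open>The added 1 covers \<open>h = 0\<close> and keeps \<open>e * enorm h < r\<close>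
    strict.\<close>
  define e where "e = r / (enorm h + 1)"
  have e: "e > 0" using r enorm_nonneg[of h] by (simp add: e_def)
  have eh: "e * enorm h < r"
    using r enorm_nonneg[of h] by (simp add: e_def field_simps)
  have gc: "g \<in> carrier_vec d" using g by (simp add: has_gradient_def)
  from g e obtain \<delta> where \<delta>: "\<delta> > 0" and bound: "\<And>y. y \<in> carrier_vec d \<Longrightarrow>
      enorm (y - (x + t \<cdot>\<^sub>v h)) < \<delta> \<Longrightarrow>
      \<bar>f y - f (x + t \<cdot>\<^sub>v h) - g \<bullet> (y - (x + t \<cdot>\<^sub>v h))\<bar> \<le> e * enorm (y - (x + t \<cdot>\<^sub>v h))"
    unfolding has_gradient_def by meson
  show "\<exists>s>0. \<forall>xa. xa \<noteq> 0 \<and> norm (xa - 0) < s \<longrightarrow>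
      norm ((f (x + (t + xa) \<cdot>\<^sub>v h) - f (x + t \<cdot>\<^sub>v h)) / xa - g \<bullet> h) < r"
  proof (intro exI[of _ "\<delta> / (enorm h + 1)"] conjI allI impI)
    show "0 < \<delta> / (enorm h + 1)" using \<delta> enorm_nonneg[of h] by simp
    fix s :: real assume s: "s \<noteq> 0 \<and> norm (s - 0) < \<delta> / (enorm h + 1)"
    have diff: "x + (t + s) \<cdot>\<^sub>v h - (x + t \<cdot>\<^sub>v h) = s \<cdot>\<^sub>v h"
      using x h by (intro eq_vecI) (auto simp: algebra_simps)
    have "\<bar>s\<bar> * (enorm h + 1) < \<delta>"
      using s enorm_nonneg[of h] by (simp add: field_simps)
    then have "\<bar>s\<bar> * enorm h < \<delta>" using s by (simp add: algebra_simps)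
    then have "\<bar>f (x + (t + s) \<cdot>\<^sub>v h) - f (x + t \<cdot>\<^sub>v h) - s * (g \<bullet> h)\<bar> \<le> e * (\<bar>s\<bar> * enorm h)"
      using bound[of "x + (t + s) \<cdot>\<^sub>v h"] x h gc by (simp add: diff enorm_smult)
    also have "\<dots> < r * \<bar>s\<bar>" using eh s by (simp add: mult.commute mult.left_commute)
    finally have "\<bar>f (x + (t + s) \<cdot>\<^sub>v h) - f (x + t \<cdot>\<^sub>v h) - s * (g \<bullet> h)\<bar> / \<bar>s\<bar> < r"
      using s by (simp add: field_simps)
    moreover have "(f (x + (t + s) \<cdot>\<^sub>v h) - f (x + t \<cdot>\<^sub>v h)) / s - g \<bullet> h
        = (f (x + (t + s) \<cdot>\<^sub>v h) - f (x + t \<cdot>\<^sub>v h) - s * (g \<bullet> h)) / s"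
      using s by (simp add: field_simps)
    ultimately show "norm ((f (x + (t + s) \<cdot>\<^sub>v h) - f (x + t \<cdot>\<^sub>v h)) / s - g \<bullet> h) < r"
      by (simp add: abs_divide)
  qed
qed

lemma has_gradient_line_0:
  assumes "has_gradient d f g x" and x: "x \<in> carrier_vec d" and h: "h \<in> carrier_vec d"
  shows "((\<lambda>t. f (x + t \<cdot>\<^sub>v h)) has_real_derivative (g \<bullet> h)) (at 0)"
proof -
  have "x + 0 \<cdot>\<^sub>v h = x" using x h by (intro eq_vecI) auto
  then show ?thesis using has_gradient_line[of d f g x 0 h] assms by simp
qed

text \<open>Derivatives along the unit vectors determine every coordinate of a gradient. This gives
  the definite description in \<open>grad\<close> its meaning.\<close>

lemma has_gradient_unique:
  assumes "has_gradient d f g x" "has_gradient d f g' x" and x: "x \<in> carrier_vec d"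
  shows "g = g'"
proof (rule eq_vecI)
  have c: "g \<in> carrier_vec d" "g' \<in> carrier_vec d" using assms by (auto simp: has_gradient_def)
  then show "dim_vec g = dim_vec g'" by simp
  fix j assume "j < dim_vec g'"
  then have j: "j < d" using c by simp
  have "g \<bullet> unit_vec d j = g' \<bullet> unit_vec d j"
    by (rule DERIV_unique[OF has_gradient_line_0 has_gradient_line_0]) (use assms in auto)
  then show "g $ j = g' $ j" using j by simp
qed

lemma grad_eqI: "has_gradient d f g x \<Longrightarrow> x \<in> carrier_vec d \<Longrightarrow> grad d f x = g"
  unfolding grad_def by (rule the_equality) (auto intro: has_gradient_unique)

lemma smooth_has_gradient:
  "smooth_fun d L f \<Longrightarrow> x \<in> carrier_vec d \<Longrightarrow> has_gradient d f (grad d f x) x"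
  unfolding smooth_fun_def by (metis grad_eqI)

lemma smooth_grad_carrier:
  "smooth_fun d L f \<Longrightarrow> x \<in> carrier_vec d \<Longrightarrow> grad d f x \<in> carrier_vec d"
  using smooth_has_gradient[of d L f x] by (simp add: has_gradient_def)

text \<open>Along an axis outside \<open>T\<close> the function is constant, so the partial
  derivative vanishes.\<close>

lemma grad_supported:
  assumes sm: "smooth_fun d L f" and sup: "supported_on d T f"
    and x: "x \<in> carrier_vec d" and j: "j < d" "j \<notin> T" and T: "T \<subseteq> {..<d}"
  shows "grad d f x $ j = 0"
proof -
  have "f (x + t \<cdot>\<^sub>v unit_vec d j) = f x" for t
  proof -
    have "(x + t \<cdot>\<^sub>v unit_vec d j) $ k = x $ k" if "k \<in> T" for k
    proof -
      have "k < d" "k \<noteq> j" using that j T by auto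
      then show ?thesis using x j by simp
    qed
    moreover have "x + t \<cdot>\<^sub>v unit_vec d j \<in> carrier_vec d" using x by simp
    ultimately show ?thesis using sup x unfolding supported_on_def by metis
  qed
  then have "((\<lambda>t. f x) has_real_derivative (grad d f x \<bullet> unit_vec d j)) (at 0)"
    using has_gradient_line_0[OF smooth_has_gradient[OF sm x] x unit_vec_carrier[of d j]] by simp
  from DERIV_unique[OF this DERIV_const] show ?thesis using j by simp
qed

section \<open>Inequalities for convex and smooth functions\<close>

text \<open>By convexity the difference quotients along the segment are at most
  \<open>f y - f x\<close> for 0 < t < 1, and they tend to the directional derivative as t decreases
  to 0.\<close>

lemma convex_above_tangent:
  assumes cv: "convex_fun d f" and g: "has_gradient d f g x"
    and x: "x \<in> carrier_vec d" and y: "y \<in> carrier_vec d"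
  shows "f x + g \<bullet> (y - x) \<le> f y"
proof -
  have h: "y - x \<in> carrier_vec d" using x y by simp
  have "((\<lambda>t. f (x + t \<cdot>\<^sub>v (y - x))) has_real_derivative (g \<bullet> (y - x))) (at 0)"
    by (rule has_gradient_line_0[OF g x h])
  moreover have "x + 0 \<cdot>\<^sub>v (y - x) = x" using x y by (intro eq_vecI) auto
  ultimately have "((\<lambda>t. (f (x + t \<cdot>\<^sub>v (y - x)) - f x) / t) \<longlongrightarrow> g \<bullet> (y - x)) (at_right 0)"
    by (auto simp: DERIV_def intro: filterlim_mono[OF _ order.refl at_le])
  moreover have "eventually (\<lambda>t. (f (x + t \<cdot>\<^sub>v (y - x)) - f x) / t \<le> f y - f x) (at_right 0)"
  proof -
    have "(f (x + t \<cdot>\<^sub>v (y - x)) - f x) / t \<le> f y - f x" if t: "0 < t" "t < 1" for t :: real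
    proof -
      have "x + t \<cdot>\<^sub>v (y - x) = (1 - t) \<cdot>\<^sub>v x + t \<cdot>\<^sub>v y"
        using x y by (intro eq_vecI) (auto simp: algebra_simps)
      moreover have "f ((1 - t) \<cdot>\<^sub>v x + t \<cdot>\<^sub>v y) \<le> (1 - t) * f x + t * f y"
        using cv x y t unfolding convex_fun_def by simp
      ultimately show ?thesis using t by (simp add: field_simps)
    qed
    then show ?thesis
      by (auto simp: eventually_at_right_field intro!: exI[of _ 1])
  qed
  ultimately have "g \<bullet> (y - x) \<le> f y - f x"
    by (rule tendsto_upperbound) simp
  then show ?thesis by simp
qed

lemma smooth_below_parabola:
  assumes sm: "smooth_fun d L f" and x: "x \<in> carrier_vec d" and h: "h \<in> carrier_vec d"
  shows "f (x + h) \<le> f x + grad d f x \<bullet> h + L / 2 * (enorm h)\<^sup>2"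
proof -
  define \<psi> where
    "\<psi> t = f (x + t \<cdot>\<^sub>v h) - t * (grad d f x \<bullet> h) - L * t\<^sup>2 / 2 * (enorm h)\<^sup>2" for t
  have "\<psi> 1 \<le> \<psi> 0"
  proof (rule DERIV_nonpos_imp_nonincreasing[where f = \<psi> and a = 0 and b = 1])
    fix t :: real assume t: "0 \<le> t" "t \<le> 1"
    have xt: "x + t \<cdot>\<^sub>v h \<in> carrier_vec d" using x h by simp
    note gc = smooth_grad_carrier[OF sm xt] smooth_grad_carrier[OF sm x]
    have "(\<psi> has_real_derivative
        (grad d f (x + t \<cdot>\<^sub>v h) \<bullet> h - grad d f x \<bullet> h - L * t * (enorm h)\<^sup>2)) (at t)"
      unfolding \<psi>_def
      by (rule derivative_eq_intros has_gradient_line[OF smooth_has_gradient[OF sm xt] x h] refl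
          | simp)+
    moreover have "grad d f (x + t \<cdot>\<^sub>v h) \<bullet> h - grad d f x \<bullet> h \<le> L * t * (enorm h)\<^sup>2"
    proof -
      have d: "x + t \<cdot>\<^sub>v h - x = t \<cdot>\<^sub>v h" using x h by (intro eq_vecI) auto
      have "grad d f (x + t \<cdot>\<^sub>v h) \<bullet> h - grad d f x \<bullet> h
          = (grad d f (x + t \<cdot>\<^sub>v h) - grad d f x) \<bullet> h"
        using gc h by (simp add: minus_scalar_prod_distrib)
      also have "\<dots> \<le> enorm (grad d f (x + t \<cdot>\<^sub>v h) - grad d f x) * enorm h"
        by (rule scalar_prod_le_enorm) (use gc h in auto)
      also have "\<dots> \<le> (L * enorm (x + t \<cdot>\<^sub>v h - x)) * enorm h"
        using sm xt x by (intro mult_right_mono) (auto simp: smooth_fun_def enorm_nonneg)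
      finally show ?thesis using t by (simp add: d enorm_smult power2_eq_square)
    qed
    ultimately show "\<exists>y. DERIV \<psi> t :> y \<and> y \<le> 0"
      by (intro exI conjI) auto
  qed simp
  moreover have "x + 0 \<cdot>\<^sub>v h = x" "x + 1 \<cdot>\<^sub>v h = x + h" using x h by (auto intro!: eq_vecI)
  ultimately show ?thesis by (simp add: \<psi>_def)
qed

lemma convex_smooth_cocoercive:
  assumes cv: "convex_fun d f" and sm: "smooth_fun d L f" and L: "L > 0"
    and x: "x \<in> carrier_vec d" and y: "y \<in> carrier_vec d"
  shows "f y + grad d f y \<bullet> (x - y) + 1 / (2 * L) * (enorm (grad d f y - grad d f x))\<^sup>2 \<le> f x"
proof -
  define a b where "a = grad d f x" and "b = grad d f y"
  have c: "a \<in> carrier_vec d" "b \<in> carrier_vec d"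
    using smooth_grad_carrier[OF sm] x y by (auto simp: a_def b_def)
  \<comment> \<open>At \<open>x + h\<close> the tangent at \<open>y\<close> lies below
    \<open>f\<close> and the parabola at \<open>x\<close> above it. This \<open>h\<close> minimizes
    the parabola minus the tangent, hence gives the sharpest comparison.\<close>
  define h where "h = (1 / L) \<cdot>\<^sub>v (b - a)"
  have h: "h \<in> carrier_vec d" using c by (simp add: h_def)
  have "f y + b \<bullet> (x + h - y) \<le> f (x + h)"
    unfolding b_def using x y h
    by (intro convex_above_tangent[OF cv smooth_has_gradient[OF sm y]]) auto
  also have "\<dots> \<le> f x + a \<bullet> h + L / 2 * (enorm h)\<^sup>2"
    unfolding a_def by (rule smooth_below_parabola[OF sm x h])
  finally have *: "f y + b \<bullet> (x + h - y) \<le> f x + a \<bullet> h + L / 2 * (enorm h)\<^sup>2" .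
  have "x + h - y = (x - y) + h" using x y h by (intro eq_vecI) auto
  then have "b \<bullet> (x + h - y) = b \<bullet> (x - y) + b \<bullet> h"
    using scalar_prod_add_distrib[of b d "x - y" h] x y h c by (simp only: minus_carrier_vec)
  with * have "f y + b \<bullet> (x - y) + (b \<bullet> h - a \<bullet> h) \<le> f x + L / 2 * (enorm h)\<^sup>2"
    by linarith
  moreover have "b \<bullet> h - a \<bullet> h = 1 / L * (enorm (b - a))\<^sup>2"
    using c by (simp add: h_def enorm_square minus_scalar_prod_distrib[of _ d] diff_divide_distrib)
  moreover have "L / 2 * (enorm h)\<^sup>2 = 1 / (2 * L) * (enorm (b - a))\<^sup>2"
    using L by (simp add: h_def enorm_smult power_mult_distrib power2_eq_square)
  moreover have "1 / L * (enorm (b - a))\<^sup>2 = 2 * (1 / (2 * L) * (enorm (b - a))\<^sup>2)"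
    by simp
  ultimately show ?thesis unfolding a_def b_def by linarith
qed

section \<open>Convexity and gradient of an average\<close>

lemma convex_avg_fun:
  assumes "\<And>i. i < n \<Longrightarrow> convex_fun d (F i)"
  shows "convex_fun d (avg_fun n F)"
  unfolding convex_fun_def avg_fun_def
proof (intro ballI allI impI)
  fix x y :: "real vec" and u v :: real
  assume *: "x \<in> carrier_vec d" "y \<in> carrier_vec d" "0 \<le> u" "0 \<le> v" "u + v = 1"
  have "(\<Sum>i<n. F i (u \<cdot>\<^sub>v x + v \<cdot>\<^sub>v y)) \<le> (\<Sum>i<n. u * F i x + v * F i y)"
    using assms * unfolding convex_fun_def by (intro sum_mono) auto
  then have "(\<Sum>i<n. F i (u \<cdot>\<^sub>v x + v \<cdot>\<^sub>v y)) / real n \<le> (\<Sum>i<n. u * F i x + v * F i y) / real n"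
    by (rule divide_right_mono) simp
  then show "(\<Sum>i<n. F i (u \<cdot>\<^sub>v x + v \<cdot>\<^sub>v y)) / real n
      \<le> u * ((\<Sum>i<n. F i x) / real n) + v * ((\<Sum>i<n. F i y) / real n)"
    by (simp add: sum.distrib sum_distrib_left add_divide_distrib)
qed

lemma has_gradient_avg_fun:
  assumes n: "n \<ge> 1" and g: "\<And>i. i < n \<Longrightarrow> has_gradient d (F i) (g i) x"
    and x: "x \<in> carrier_vec d"
  shows "has_gradient d (avg_fun n F) (vec d (\<lambda>j. (\<Sum>i<n. g i $ j) / real n)) x"
  unfolding has_gradient_def
proof (intro conjI allI impI)
  let ?g = "vec d (\<lambda>j. (\<Sum>i<n. g i $ j) / real n)"
  fix e :: real assume e: "e > 0"
  have "\<forall>i\<in>{..<n}. \<exists>\<delta>>0. \<forall>y\<in>carrier_vec d. enorm (y - x) < \<delta> \<longrightarrow>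
      \<bar>F i y - F i x - g i \<bullet> (y - x)\<bar> \<le> e * enorm (y - x)"
    using g e unfolding has_gradient_def by simp
  then obtain \<delta> where \<delta>: "\<And>i. i < n \<Longrightarrow> \<delta> i > 0" and b: "\<And>i y. i < n \<Longrightarrow> y \<in> carrier_vec d \<Longrightarrow>
      enorm (y - x) < \<delta> i \<Longrightarrow> \<bar>F i y - F i x - g i \<bullet> (y - x)\<bar> \<le> e * enorm (y - x)"
    by (metis lessThan_iff)
  have ne: "finite (\<delta> ` {..<n})" "\<delta> ` {..<n} \<noteq> {}" using n by (auto simp: lessThan_empty_iff)
  show "\<exists>\<delta>>0. \<forall>y\<in>carrier_vec d. enorm (y - x) < \<delta> \<longrightarrow>
      \<bar>avg_fun n F y - avg_fun n F x - ?g \<bullet> (y - x)\<bar> \<le> e * enorm (y - x)"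
  proof (intro exI[of _ "Min (\<delta> ` {..<n})"] conjI ballI impI)
    show "0 < Min (\<delta> ` {..<n})" using ne \<delta> by (subst Min_gr_iff) auto
    fix y assume y: "y \<in> carrier_vec d" and "enorm (y - x) < Min (\<delta> ` {..<n})"
    then have lt: "enorm (y - x) < \<delta> i" if "i < n" for i
      using ne that by (subst (asm) Min_gr_iff) auto
    have "?g \<bullet> (y - x) = (\<Sum>j<d. (\<Sum>i<n. g i $ j) / real n * (y - x) $ j)"
      using x y by (subst scalar_prod_sum[of _ d]) auto
    also have "\<dots> = (\<Sum>j<d. \<Sum>i<n. g i $ j * (y - x) $ j) / real n"
      by (simp add: sum_distrib_right sum_divide_distrib)
    also have "\<dots> = (\<Sum>i<n. \<Sum>j<d. g i $ j * (y - x) $ j) / real n"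
      by (subst sum.swap) simp
    also have "\<dots> = (\<Sum>i<n. g i \<bullet> (y - x)) / real n"
      using x y by (simp add: scalar_prod_sum[of _ d])
    finally have "avg_fun n F y - avg_fun n F x - ?g \<bullet> (y - x)
        = (\<Sum>i<n. F i y - F i x - g i \<bullet> (y - x)) / real n"
      by (simp add: avg_fun_def sum_subtractf diff_divide_distrib)
    also have "\<bar>\<dots>\<bar> = \<bar>\<Sum>i<n. F i y - F i x - g i \<bullet> (y - x)\<bar> / real n"
      by (simp add: abs_divide)
    also have "\<dots> \<le> (\<Sum>i<n. e * enorm (y - x)) / real n"
    proof (rule divide_right_mono)
      show "\<bar>\<Sum>i<n. F i y - F i x - g i \<bullet> (y - x)\<bar> \<le> (\<Sum>i<n. e * enorm (y - x))"
        by (rule order.trans[OF sum_abs sum_mono]) (use b y lt in auto)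
    qed simp
    also have "\<dots> = e * enorm (y - x)" using n by simp
    finally show "\<bar>avg_fun n F y - avg_fun n F x - ?g \<bullet> (y - x)\<bar> \<le> e * enorm (y - x)" .
  qed
qed simp

section \<open>One inner iteration\<close>

text \<open>The sign of \<open>L\<close> is left open so that \<open>L > 0\<close> can be derived
  inside this locale; \<open>svrg_run\<close> is entered only afterwards.\<close>

locale sparse_finite_sum =
  fixes d n :: nat and F :: "nat \<Rightarrow> real vec \<Rightarrow> real" and T :: "nat \<Rightarrow> nat set" and L :: real
  assumes n: "n \<ge> 1"
    and T: "\<And>i. i < n \<Longrightarrow> T i \<subseteq> {..<d}"
    and cover: "\<And>v. v < d \<Longrightarrow> \<exists>i<n. v \<in> T i"
    and cvx: "\<And>i. i < n \<Longrightarrow> convex_fun d (F i)"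
    and smooth: "\<And>i. i < n \<Longrightarrow> smooth_fun d L (F i)"
    and supported: "\<And>i. i < n \<Longrightarrow> supported_on d (T i) (F i)"
begin

abbreviation "f \<equiv> avg_fun n F"

abbreviation "Df x \<equiv> D_mat d n T *\<^sub>v grad d f x"

lemma f_has_gradient:
  assumes "x \<in> carrier_vec d"
  shows "has_gradient d f (vec d (\<lambda>j. (\<Sum>i<n. grad d (F i) x $ j) / real n)) x"
  using n assms by (intro has_gradient_avg_fun smooth_has_gradient[OF smooth])

lemma grad_f:
  "x \<in> carrier_vec d \<Longrightarrow> grad d f x = vec d (\<lambda>j. (\<Sum>i<n. grad d (F i) x $ j) / real n)"
  by (simp add: grad_eqI f_has_gradient)

lemma grad_f_carrier: "x \<in> carrier_vec d \<Longrightarrow> grad d f x \<in> carrier_vec d"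
  by (simp add: grad_f)

lemma grad_F_carrier: "i < n \<Longrightarrow> x \<in> carrier_vec d \<Longrightarrow> grad d (F i) x \<in> carrier_vec d"
  by (rule smooth_grad_carrier[OF smooth])

lemma convex_f: "convex_fun d f"
  by (rule convex_avg_fun[OF cvx])

lemma f_above_tangent:
  "x \<in> carrier_vec d \<Longrightarrow> y \<in> carrier_vec d \<Longrightarrow> f x + grad d f x \<bullet> (y - x) \<le> f y"
  by (rule convex_above_tangent[OF convex_f]) (simp_all add: grad_f f_has_gradient)

lemma grad_f_scalar_prod:
  assumes "x \<in> carrier_vec d" "h \<in> carrier_vec d"
  shows "grad d f x \<bullet> h = (\<Sum>i<n. grad d (F i) x \<bullet> h) / real n"
proof -
  have "grad d f x \<bullet> h = (\<Sum>j<d. \<Sum>i<n. grad d (F i) x $ j * h $ j) / real n"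
    using assms by (simp add: scalar_prod_sum[of _ d] grad_f sum_distrib_right sum_divide_distrib)
  also have "\<dots> = (\<Sum>i<n. \<Sum>j<d. grad d (F i) x $ j * h $ j) / real n"
    by (subst sum.swap) simp
  finally show ?thesis using assms by (simp add: scalar_prod_sum[of _ d])
qed

lemma f_below_parabola:
  assumes "x \<in> carrier_vec d" "h \<in> carrier_vec d"
  shows "f (x + h) \<le> f x + grad d f x \<bullet> h + L / 2 * (enorm h)\<^sup>2"
proof -
  have "(\<Sum>i<n. F i (x + h)) \<le> (\<Sum>i<n. F i x + grad d (F i) x \<bullet> h + L / 2 * (enorm h)\<^sup>2)"
    using assms smooth by (intro sum_mono smooth_below_parabola) auto
  then have "f (x + h) \<le> (\<Sum>i<n. F i x + grad d (F i) x \<bullet> h + L / 2 * (enorm h)\<^sup>2) / real n"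
    unfolding avg_fun_def by (rule divide_right_mono) simp
  also have "\<dots> = f x + grad d f x \<bullet> h + L / 2 * (enorm h)\<^sup>2"
    using n by (simp add: grad_f_scalar_prod assms avg_fun_def sum.distrib add_divide_distrib)
  finally show ?thesis .
qed

text \<open>Cocoercivity is averaged over the components instead of being applied to
  \<open>f\<close>, because the second moment of the estimator contains the individual gradient
  differences.\<close>

lemma f_cocoercive:
  assumes "L > 0" "x \<in> carrier_vec d" "y \<in> carrier_vec d"
  shows "f y + grad d f y \<bullet> (x - y)
    + 1 / (2 * L) * ((\<Sum>i<n. (enorm (grad d (F i) y - grad d (F i) x))\<^sup>2) / real n) \<le> f x"
proof -
  have "(\<Sum>i<n. F i y + grad d (F i) y \<bullet> (x - y)
        + 1 / (2 * L) * (enorm (grad d (F i) y - grad d (F i) x))\<^sup>2) \<le> (\<Sum>i<n. F i x)"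
    using assms smooth cvx by (intro sum_mono convex_smooth_cocoercive) auto
  then have "(\<Sum>i<n. F i y + grad d (F i) y \<bullet> (x - y)
        + 1 / (2 * L) * (enorm (grad d (F i) y - grad d (F i) x))\<^sup>2) / real n \<le> f x"
    unfolding avg_fun_def by (rule divide_right_mono) simp
  moreover have "grad d f y \<bullet> (x - y) = (\<Sum>i<n. grad d (F i) y \<bullet> (x - y)) / real n"
    using assms by (intro grad_f_scalar_prod) auto
  ultimately show ?thesis
    by (simp add: avg_fun_def sum.distrib add_divide_distrib flip: sum_distrib_left sum_divide_distrib)
qed

text \<open>If \<open>d = 0\<close> then \<open>L\<close> may be negative, since all norms vanish.\<close>

lemma growth_le_smoothness:
  assumes "d \<ge> 1" "xstar \<in> carrier_vec d" "quadratic_growth d \<mu> f xstar"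
  shows "\<mu> \<le> L"
proof -
  define e where "e = (unit_vec d 0 :: real vec)"
  have e: "e \<in> carrier_vec d" by (simp add: e_def)
  have ee: "(enorm e)\<^sup>2 = 1" using assms(1) by (simp add: e_def enorm_square)
  have g: "grad d f xstar \<in> carrier_vec d" using assms grad_f_carrier by blast
  \<comment> \<open>Probing in two opposite directions cancels the gradient term upon addition, so
    it need not be shown that the gradient vanishes at \<open>xstar\<close>.\<close>
  have "xstar + e - xstar = e" "xstar + - e - xstar = - e" using assms e by (auto intro!: eq_vecI)
  then have "\<mu> / 2 * 1 \<le> f (xstar + e) - f xstar" "\<mu> / 2 * 1 \<le> f (xstar + - e) - f xstar"
    using assms(2,3) e ee unfolding quadratic_growth_def
    by (metis add_carrier_vec, metis add_carrier_vec uminus_carrier_vec enorm_uminus)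
  moreover have "f (xstar + e) \<le> f xstar + grad d f xstar \<bullet> e + L / 2 * (enorm e)\<^sup>2"
    "f (xstar + - e) \<le> f xstar + grad d f xstar \<bullet> (- e) + L / 2 * (enorm (- e))\<^sup>2"
    using assms e by (simp_all only: f_below_parabola uminus_carrier_vec)
  moreover have "grad d f xstar \<bullet> (- e) = - (grad d f xstar \<bullet> e)"
    using g e by (simp add: scalar_prod_sum[of _ d] sum_negf)
  ultimately show ?thesis by (simp add: ee enorm_uminus)
qed

section \<open>The matrix \<open>D\<close> and its averaged action\<close>

lemma avg_proj_diag:
  assumes "a < d"
  shows "avg_proj_mat d n T $$ (a, a) > 0"
proof -
  obtain i where i: "i < n" "a \<in> T i" using cover assms by blast
  have "0 < (\<Sum>i<n. proj_mat d (T i) $$ (a, a))"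
    by (rule sum_pos2[of _ i]) (use i assms in \<open>auto simp: proj_mat_def\<close>)
  then show ?thesis using assms n by (simp add: avg_proj_mat_def)
qed

lemma avg_proj_offdiag: "a < d \<Longrightarrow> b < d \<Longrightarrow> a \<noteq> b \<Longrightarrow> avg_proj_mat d n T $$ (a, b) = 0"
  by (simp add: avg_proj_mat_def proj_mat_def)

text \<open>\<open>mat_inverse\<close> is guaranteed to return a value on units of the matrix ring,
  hence the explicit two-sided inverse \<open>B\<close>. From here on only the product equation is
  used, never the entries of \<open>D\<close>.\<close>

lemma D_mat_inverse:
  "D_mat d n T \<in> carrier_mat d d" "avg_proj_mat d n T * D_mat d n T = 1\<^sub>m d"
proof -
  let ?A = "avg_proj_mat d n T"
  define B where "B = mat d d (\<lambda>(a, b). if a = b then 1 / ?A $$ (a, a) else 0)"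
  have A: "?A \<in> carrier_mat d d" by (simp add: avg_proj_mat_def)
  have B: "B \<in> carrier_mat d d" by (simp add: B_def)
  have AB: "?A * B = 1\<^sub>m d"
  proof (rule eq_matI)
    fix a b assume "a < dim_row (1\<^sub>m d)" "b < dim_col (1\<^sub>m d)"
    then have ab: "a < d" "b < d" by auto
    have "(?A * B) $$ (a, b) = (\<Sum>k<d. ?A $$ (a, k) * B $$ (k, b))"
      using ab A B by (simp add: scalar_prod_def atLeast0LessThan)
    also have "\<dots> = (\<Sum>k<d. if k = b then ?A $$ (a, b) / ?A $$ (b, b) else 0)"
      using ab by (intro sum.cong) (auto simp: B_def)
    also have "\<dots> = ?A $$ (a, b) / ?A $$ (b, b)" using ab by simp
    also have "\<dots> = 1\<^sub>m d $$ (a, b)"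
      using ab avg_proj_diag[of b] avg_proj_offdiag[of a b] by (cases "a = b") auto
    finally show "(?A * B) $$ (a, b) = 1\<^sub>m d $$ (a, b)" .
  qed (use A B in auto)
  have BA: "B * ?A = 1\<^sub>m d"
  proof (rule eq_matI)
    fix a b assume "a < dim_row (1\<^sub>m d)" "b < dim_col (1\<^sub>m d)"
    then have ab: "a < d" "b < d" by auto
    have "(B * ?A) $$ (a, b) = (\<Sum>k<d. B $$ (a, k) * ?A $$ (k, b))"
      using ab A B by (simp add: scalar_prod_def atLeast0LessThan)
    also have "\<dots> = (\<Sum>k<d. if k = a then ?A $$ (a, b) / ?A $$ (a, a) else 0)"
      using ab by (intro sum.cong) (auto simp: B_def)
    also have "\<dots> = ?A $$ (a, b) / ?A $$ (a, a)" using ab by simp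
    also have "\<dots> = 1\<^sub>m d $$ (a, b)"
      using ab avg_proj_diag[of a] avg_proj_offdiag[of a b] by (cases "a = b") auto
    finally show "(B * ?A) $$ (a, b) = 1\<^sub>m d $$ (a, b)" .
  qed (use A B in auto)
  have "?A \<in> Units (ring_mat TYPE(real) d ())"
    unfolding Units_def using A B AB BA by (auto simp: ring_mat_simps)
  then obtain C where C: "mat_inverse ?A = Some C"
    using mat_inverse(1)[OF A, of "()"] by (cases "mat_inverse ?A") auto
  show "D_mat d n T \<in> carrier_mat d d" "?A * D_mat d n T = 1\<^sub>m d"
    using mat_inverse(2)[OF A C] by (auto simp: D_mat_def C)
qed

lemma D_vec_carrier: "x \<in> carrier_vec d \<Longrightarrow> D_mat d n T *\<^sub>v x \<in> carrier_vec d"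
  using D_mat_inverse(1) by simp

lemma proj_mat_vec:
  assumes "u \<in> carrier_vec d" "v < d"
  shows "(proj_mat d S *\<^sub>v u) $ v = (if v \<in> S then u $ v else 0)"
proof -
  have "(proj_mat d S *\<^sub>v u) $ v = (\<Sum>k<d. proj_mat d S $$ (v, k) * u $ k)"
    using assms scalar_prod_sum[of u d] by (simp add: proj_mat_def)
  also have "\<dots> = (\<Sum>k<d. if k = v then (if v \<in> S then u $ v else 0) else 0)"
    using assms by (intro sum.cong) (auto simp: proj_mat_def)
  finally show ?thesis using assms by simp
qed

lemma Di_mat_vec:
  assumes "x \<in> carrier_vec d"
  shows "Di_mat d n T i *\<^sub>v x = proj_mat d (T i) *\<^sub>v (D_mat d n T *\<^sub>v x)"
  unfolding Di_mat_def
  by (rule assoc_mult_mat_vec[of _ d d _ d]) (use D_mat_inverse(1) assms in \<open>auto simp: proj_mat_def\<close>)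

lemma avg_D_vec:
  assumes x: "x \<in> carrier_vec d" and v: "v < d"
  shows "(\<Sum>i<n. if v \<in> T i then (D_mat d n T *\<^sub>v x) $ v else 0) / real n = x $ v"
proof -
  define u where "u = D_mat d n T *\<^sub>v x"
  have u: "u \<in> carrier_vec d" using D_vec_carrier x by (simp add: u_def)
  have A: "avg_proj_mat d n T \<in> carrier_mat d d" by (simp add: avg_proj_mat_def)
  have "x = avg_proj_mat d n T *\<^sub>v u"
    using x A D_mat_inverse by (simp add: u_def flip: assoc_mult_mat_vec)
  then have "x $ v = (\<Sum>k<d. avg_proj_mat d n T $$ (v, k) * u $ k)"
    using v A u by (simp add: scalar_prod_sum[of _ d])
  also have "\<dots> = (\<Sum>k<d. if k = v then avg_proj_mat d n T $$ (v, v) * u $ v else 0)"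
    using v avg_proj_offdiag by (intro sum.cong) auto
  also have "\<dots> = avg_proj_mat d n T $$ (v, v) * u $ v" using v by simp
  also have "\<dots> = (\<Sum>i<n. if v \<in> T i then u $ v else 0) / real n"
    using v by (auto simp: avg_proj_mat_def proj_mat_def sum_distrib_right intro!: sum.cong)
  finally show ?thesis unfolding u_def by simp
qed

section \<open>Estimator and progress of a single step\<close>

lemma y_point_carrier:
  "xt \<in> carrier_vec d \<Longrightarrow> z \<in> carrier_vec d \<Longrightarrow> y_point d n F T \<theta> \<phi> xt z \<in> carrier_vec d"
  by (simp add: y_point_def D_vec_carrier grad_f_carrier)

lemma grad_estimator_carrier:
  assumes "i < n" "xt \<in> carrier_vec d" "y \<in> carrier_vec d"
  shows "grad_estimator d n F T xt y i \<in> carrier_vec d"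
proof -
  have "proj_mat d (T i) \<in> carrier_mat d d" by (simp add: proj_mat_def)
  then have "Di_mat d n T i *\<^sub>v grad d f xt \<in> carrier_vec d"
    using assms by (simp add: Di_mat_vec grad_f_carrier D_vec_carrier)
  then show ?thesis using assms grad_F_carrier[of i] by (simp add: grad_estimator_def)
qed

text \<open>All projections are diagonal, so the square is expanded and averaged in each coordinate
  separately; norms and inner products are reassembled only at the end.\<close>

lemma sq_dist_step:
  assumes xt: "xt \<in> carrier_vec d" and z: "z \<in> carrier_vec d" and y: "y \<in> carrier_vec d"
    and w: "w \<in> carrier_vec d"
  shows "(\<Sum>i<n. (enorm (z - \<eta> \<cdot>\<^sub>v grad_estimator d n F T xt y i - w))\<^sup>2) / real n
    \<le> (enorm (z - w))\<^sup>2 - 2 * \<eta> * (grad d f y \<bullet> (z - w))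
      + \<eta>\<^sup>2 * ((\<Sum>i<n. (enorm (grad d (F i) y - grad d (F i) xt))\<^sup>2) / real n)
      + 2 * \<eta>\<^sup>2 * (grad d f y \<bullet> Df xt)"
proof -
  define u where "u = Df xt"
  have u: "u \<in> carrier_vec d" using xt by (simp add: u_def D_vec_carrier grad_f_carrier)
  define a b where "a i v = grad d (F i) y $ v" and "b i v = grad d (F i) xt $ v" for i v
  define p where "p i v = (if v \<in> T i then u $ v else 0)" for i v
  have est: "grad_estimator d n F T xt y i $ v = a i v - b i v + p i v" if "i < n" "v < d" for i v
  proof -
    have "Di_mat d n T i *\<^sub>v grad d f xt = proj_mat d (T i) *\<^sub>v u"
      using xt by (simp add: Di_mat_vec grad_f_carrier u_def)
    moreover have "dim_vec (proj_mat d (T i) *\<^sub>v u) = d" by (simp add: proj_mat_def)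
    moreover have "dim_vec (grad d (F i) xt) = d" using grad_F_carrier[OF that(1) xt] by simp
    ultimately show ?thesis
      using that proj_mat_vec[OF u that(2), of "T i"]
      by (simp add: grad_estimator_def a_def b_def p_def del: index_mult_mat_vec)
  qed
  have key: "(\<Sum>i<n. (z $ v - \<eta> * (a i v - b i v + p i v) - w $ v)\<^sup>2) / real n
      \<le> (z $ v - w $ v)\<^sup>2 - 2 * \<eta> * (grad d f y $ v * (z $ v - w $ v))
        + \<eta>\<^sup>2 * ((\<Sum>i<n. (a i v - b i v)\<^sup>2) / real n) + 2 * \<eta>\<^sup>2 * (grad d f y $ v * u $ v)"
    if v: "v < d" for v
  proof -
    \<comment> \<open>Sparsity enters here: where \<open>p\<close> differs from \<open>u\<close>,
      both component gradients vanish. So the random projection disappears from the cross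
      terms.\<close>
    have ap: "a i v * p i v = a i v * u $ v" "b i v * p i v = b i v * u $ v" if "i < n" for i
    proof -
      have "grad d (F i) x $ v = 0" if "x \<in> carrier_vec d" "v \<notin> T i" for x
        by (rule grad_supported[OF smooth supported]) (use \<open>i < n\<close> that v T in auto)
      then show "a i v * p i v = a i v * u $ v" "b i v * p i v = b i v * u $ v"
        using xt y by (auto simp: a_def b_def p_def)
    qed
    have pp: "(p i v)\<^sup>2 = p i v * u $ v" for i by (simp add: p_def power2_eq_square)
    have sa: "(\<Sum>i<n. a i v) = real n * grad d f y $ v"
      using n v y by (simp add: grad_f a_def)
    have sb: "(\<Sum>i<n. b i v) = real n * grad d f xt $ v"
      using n v xt by (simp add: grad_f b_def)
    have sp: "(\<Sum>i<n. p i v) = real n * grad d f xt $ v"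
      using avg_D_vec[OF grad_f_carrier[OF xt] v, folded u_def] n by (simp add: p_def field_simps)
    \<comment> \<open>The product is the average of the squares \<open>(p i v)\<^sup>2\<close>,
      which gives its sign without knowing the diagonal of \<open>D\<close>.\<close>
    have gu: "0 \<le> grad d f xt $ v * u $ v"
    proof -
      have "0 \<le> (\<Sum>i<n. (p i v)\<^sup>2)" by (rule sum_nonneg) simp
      also have "\<dots> = real n * (grad d f xt $ v * u $ v)"
        by (simp add: pp sp flip: sum_distrib_right)
      finally show ?thesis using n by (simp add: zero_le_mult_iff)
    qed
    define q where "q = z $ v - w $ v"
    have "(\<Sum>i<n. (z $ v - \<eta> * (a i v - b i v + p i v) - w $ v)\<^sup>2)
      = (\<Sum>i<n. q\<^sup>2 - 2 * \<eta> * q * (a i v - b i v + p i v) + \<eta>\<^sup>2 * (a i v - b i v)\<^sup>2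
          + 2 * \<eta>\<^sup>2 * (a i v * u $ v - b i v * u $ v) + \<eta>\<^sup>2 * (p i v * u $ v))"
    proof (rule sum.cong[OF refl])
      fix i assume "i \<in> {..<n}"
      then have "i < n" by simp
      note ap[OF this, symmetric]
      then show "(z $ v - \<eta> * (a i v - b i v + p i v) - w $ v)\<^sup>2
        = q\<^sup>2 - 2 * \<eta> * q * (a i v - b i v + p i v) + \<eta>\<^sup>2 * (a i v - b i v)\<^sup>2
          + 2 * \<eta>\<^sup>2 * (a i v * u $ v - b i v * u $ v) + \<eta>\<^sup>2 * (p i v * u $ v)"
        unfolding pp[symmetric] q_def by (simp only:) (simp add: power2_eq_square algebra_simps)
    qed
    also have "\<dots> = real n * q\<^sup>2
        - 2 * \<eta> * q * ((\<Sum>i<n. a i v) - (\<Sum>i<n. b i v) + (\<Sum>i<n. p i v))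
        + \<eta>\<^sup>2 * (\<Sum>i<n. (a i v - b i v)\<^sup>2)
        + 2 * \<eta>\<^sup>2 * ((\<Sum>i<n. a i v) * u $ v - (\<Sum>i<n. b i v) * u $ v)
        + \<eta>\<^sup>2 * ((\<Sum>i<n. p i v) * u $ v)"
      by (simp add: sum.distrib sum_subtractf flip: sum_distrib_left sum_distrib_right)
    finally have total: "(\<Sum>i<n. (z $ v - \<eta> * (a i v - b i v + p i v) - w $ v)\<^sup>2) = real n * q\<^sup>2
        - 2 * \<eta> * q * ((\<Sum>i<n. a i v) - (\<Sum>i<n. b i v) + (\<Sum>i<n. p i v))
        + \<eta>\<^sup>2 * (\<Sum>i<n. (a i v - b i v)\<^sup>2)
        + 2 * \<eta>\<^sup>2 * ((\<Sum>i<n. a i v) * u $ v - (\<Sum>i<n. b i v) * u $ v)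
        + \<eta>\<^sup>2 * ((\<Sum>i<n. p i v) * u $ v)" .
    have factor: "real n * q\<^sup>2
        - 2 * \<eta> * q * (real n * grad d f y $ v - real n * grad d f xt $ v + real n * grad d f xt $ v)
        + \<eta>\<^sup>2 * s
        + 2 * \<eta>\<^sup>2 * (real n * grad d f y $ v * u $ v - real n * grad d f xt $ v * u $ v)
        + \<eta>\<^sup>2 * (real n * grad d f xt $ v * u $ v)
      = real n * (q\<^sup>2 - 2 * \<eta> * (grad d f y $ v * q) + 2 * \<eta>\<^sup>2 * (grad d f y $ v * u $ v)
        - \<eta>\<^sup>2 * (grad d f xt $ v * u $ v)) + \<eta>\<^sup>2 * s" for s
      by (simp add: algebra_simps)
    have "(\<Sum>i<n. (z $ v - \<eta> * (a i v - b i v + p i v) - w $ v)\<^sup>2) / real n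
      = q\<^sup>2 - 2 * \<eta> * (grad d f y $ v * q)
        + \<eta>\<^sup>2 * ((\<Sum>i<n. (a i v - b i v)\<^sup>2) / real n) + 2 * \<eta>\<^sup>2 * (grad d f y $ v * u $ v)
        - \<eta>\<^sup>2 * (grad d f xt $ v * u $ v)"
      using n unfolding total sa sb sp factor by (simp add: add_divide_distrib)
    then show ?thesis using gu by (simp add: q_def)
  qed
  have "(\<Sum>i<n. (enorm (z - \<eta> \<cdot>\<^sub>v grad_estimator d n F T xt y i - w))\<^sup>2) / real n
      = (\<Sum>i<n. \<Sum>v<d. (z $ v - \<eta> * (a i v - b i v + p i v) - w $ v)\<^sup>2) / real n"
  proof -
    have "(enorm (z - \<eta> \<cdot>\<^sub>v grad_estimator d n F T xt y i - w))\<^sup>2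
        = (\<Sum>v<d. (z $ v - \<eta> * (a i v - b i v + p i v) - w $ v)\<^sup>2)" if i: "i < n" for i
      using z w grad_estimator_carrier[OF i xt y] est[OF i]
      by (subst enorm_square_sum[of _ d]) auto
    then show ?thesis by simp
  qed
  also have "\<dots> = (\<Sum>v<d. (\<Sum>i<n. (z $ v - \<eta> * (a i v - b i v + p i v) - w $ v)\<^sup>2) / real n)"
    by (subst sum.swap) (simp add: sum_divide_distrib)
  also have "\<dots> \<le> (\<Sum>v<d. (z $ v - w $ v)\<^sup>2 - 2 * \<eta> * (grad d f y $ v * (z $ v - w $ v))
        + \<eta>\<^sup>2 * ((\<Sum>i<n. (a i v - b i v)\<^sup>2) / real n) + 2 * \<eta>\<^sup>2 * (grad d f y $ v * u $ v))"
    by (rule sum_mono) (rule key, simp)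
  also have "\<dots> = (\<Sum>v<d. (z $ v - w $ v)\<^sup>2) - 2 * \<eta> * (\<Sum>v<d. grad d f y $ v * (z $ v - w $ v))
        + \<eta>\<^sup>2 * ((\<Sum>v<d. \<Sum>i<n. (a i v - b i v)\<^sup>2) / real n)
        + 2 * \<eta>\<^sup>2 * (\<Sum>v<d. grad d f y $ v * u $ v)"
    by (simp add: sum.distrib sum_subtractf flip: sum_distrib_left sum_divide_distrib)
  finally have "(\<Sum>i<n. (enorm (z - \<eta> \<cdot>\<^sub>v grad_estimator d n F T xt y i - w))\<^sup>2) / real n
      \<le> (\<Sum>v<d. (z $ v - w $ v)\<^sup>2) - 2 * \<eta> * (\<Sum>v<d. grad d f y $ v * (z $ v - w $ v))
        + \<eta>\<^sup>2 * ((\<Sum>v<d. \<Sum>i<n. (a i v - b i v)\<^sup>2) / real n)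
        + 2 * \<eta>\<^sup>2 * (\<Sum>v<d. grad d f y $ v * u $ v)" .
  moreover have "(\<Sum>v<d. \<Sum>i<n. (a i v - b i v)\<^sup>2)
      = (\<Sum>i<n. (enorm (grad d (F i) y - grad d (F i) xt))\<^sup>2)"
  proof -
    have "(enorm (grad d (F i) y - grad d (F i) xt))\<^sup>2 = (\<Sum>v<d. (a i v - b i v)\<^sup>2)"
      if "i < n" for i
      using grad_F_carrier[OF that xt] grad_F_carrier[OF that y]
      by (subst enorm_square_sum[of _ d]) (auto simp: a_def b_def)
    then show ?thesis by (subst sum.swap) simp
  qed
  moreover have "(\<Sum>v<d. (z $ v - w $ v)\<^sup>2) = (enorm (z - w))\<^sup>2"
    using z w by (simp add: enorm_square_sum[of _ d])
  moreover have "(\<Sum>v<d. grad d f y $ v * (z $ v - w $ v)) = grad d f y \<bullet> (z - w)"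
    using z w by (simp add: scalar_prod_sum[of _ d])
  moreover have "(\<Sum>v<d. grad d f y $ v * u $ v) = grad d f y \<bullet> Df xt"
    using u by (simp add: scalar_prod_sum[of _ d] u_def)
  ultimately show ?thesis by simp
qed

lemma coupling_step:
  assumes L: "L > 0" and \<theta>: "0 < \<theta>" "\<theta> < 1"
    and \<phi>: "\<phi> = (1 - \<theta>) / L" and \<eta>: "\<eta> = (1 - \<theta>) / (L * \<theta>)"
    and xt: "xt \<in> carrier_vec d" and z: "z \<in> carrier_vec d" and w: "w \<in> carrier_vec d"
    and y: "y = y_point d n F T \<theta> \<phi> xt z"
  shows "(\<Sum>i<n. (enorm (z - \<eta> \<cdot>\<^sub>v grad_estimator d n F T xt y i - w))\<^sup>2) / real n
    \<le> (enorm (z - w))\<^sup>2 - 2 * \<eta> * ((f y - f w) + (1 - \<theta>) / \<theta> * (f y - f xt))"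
proof -
  define V where "V = (\<Sum>i<n. (enorm (grad d (F i) y - grad d (F i) xt))\<^sup>2) / real n"
  have yc: "y \<in> carrier_vec d" using xt z by (simp add: y y_point_carrier)
  have g: "grad d f y \<in> carrier_vec d" by (rule grad_f_carrier[OF yc])
  define u where "u = Df xt"
  have u: "u \<in> carrier_vec d" using xt by (simp add: u_def D_vec_carrier grad_f_carrier)
  have \<eta>0: "\<eta> > 0" using L \<theta> by (simp add: \<eta>)
  have \<phi>\<eta>: "\<phi> / \<theta> = \<eta>" by (simp add: \<phi> \<eta>)
  \<comment> \<open>The definition of \<open>y\<close>, solved for \<open>z\<close>. The coefficient
    of \<open>u\<close> is \<phi> / \<theta> = \<eta>, exactly what cancels the term
    \<open>2 * \<eta>\<^sup>2 * (grad d f y \<bullet> u)\<close> of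
    \<open>sq_dist_step\<close>.\<close>
  have zw: "z - w = (y - w) + ((1 - \<theta>) / \<theta>) \<cdot>\<^sub>v (y - xt) + \<eta> \<cdot>\<^sub>v u"
  proof (rule eq_vecI)
    fix v assume "v < dim_vec ((y - w) + ((1 - \<theta>) / \<theta>) \<cdot>\<^sub>v (y - xt) + \<eta> \<cdot>\<^sub>v u)"
    then have v: "v < d" using u by simp
    have yv: "y $ v = \<theta> * z $ v + (1 - \<theta>) * xt $ v - \<phi> * u $ v"
      using v xt z u by (simp add: y y_point_def flip: u_def)
    have "\<phi> = \<eta> * \<theta>" using \<theta> by (simp add: \<phi> \<eta>)
    with yv have "z $ v - w $ v = (y $ v - w $ v) + (1 - \<theta>) / \<theta> * (y $ v - xt $ v) + \<eta> * u $ v"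
      using \<theta> by (simp add: field_simps)
    then show "(z - w) $ v = ((y - w) + ((1 - \<theta>) / \<theta>) \<cdot>\<^sub>v (y - xt) + \<eta> \<cdot>\<^sub>v u) $ v"
      using v xt z w yc u by simp
  qed (use xt z w yc u in auto)
  have inner: "grad d f y \<bullet> (z - w) = grad d f y \<bullet> (y - w)
      + (1 - \<theta>) / \<theta> * (grad d f y \<bullet> (y - xt)) + \<eta> * (grad d f y \<bullet> u)"
    unfolding zw using g yc w xt u by (simp add: scalar_prod_add_distrib[of _ d])
  have flip_diff: "grad d f y \<bullet> (x - y) = - (grad d f y \<bullet> (y - x))" if "x \<in> carrier_vec d" for x
    using g yc that by (simp add: scalar_prod_minus_distrib[of _ d])
  have 1: "f y - f w \<le> grad d f y \<bullet> (y - w)"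
    using f_above_tangent[OF yc w] flip_diff[OF w] by simp
  have 2: "f y - f xt + 1 / (2 * L) * V \<le> grad d f y \<bullet> (y - xt)"
    using f_cocoercive[OF L xt yc] flip_diff[OF xt] by (simp add: V_def)
  have "(f y - f w) + (1 - \<theta>) / \<theta> * (f y - f xt + 1 / (2 * L) * V)
      \<le> grad d f y \<bullet> (y - w) + (1 - \<theta>) / \<theta> * (grad d f y \<bullet> (y - xt))"
    using 1 2 \<theta> by (intro add_mono mult_left_mono) auto
  \<comment> \<open>The origin of \<eta>: after multiplication by 2 \<eta> the cocoercivity term is
    \<open>\<eta>\<^sup>2 * V\<close>, the same as the variance term of
    \<open>sq_dist_step\<close>.\<close>
  moreover have "(1 - \<theta>) / \<theta> * (1 / (2 * L) * V) = \<eta> * V / 2"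
    by (simp add: \<eta>)
  ultimately have "(f y - f w) + (1 - \<theta>) / \<theta> * (f y - f xt) + \<eta> * V / 2
      \<le> grad d f y \<bullet> (y - w) + (1 - \<theta>) / \<theta> * (grad d f y \<bullet> (y - xt))"
    unfolding distrib_left by linarith
  from mult_left_mono[OF this, of "2 * \<eta>"] \<eta>0
  have "2 * \<eta> * ((f y - f w) + (1 - \<theta>) / \<theta> * (f y - f xt)) + \<eta>\<^sup>2 * V
      \<le> 2 * \<eta> * (grad d f y \<bullet> (y - w) + (1 - \<theta>) / \<theta> * (grad d f y \<bullet> (y - xt)))"
    by (simp add: distrib_left power2_eq_square)
  then show ?thesis
    using sq_dist_step[OF xt z yc w, of \<eta>] unfolding inner V_def[symmetric] u_def[symmetric]
    by (simp add: distrib_left power2_eq_square)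
qed

end

section \<open>Expectations over a round\<close>

text \<open>Every distribution in the algorithm has finite support, so the tower rule holds for
  arbitrary real functions, without separate integrability conditions.\<close>

lemma expectation_bind_finite:
  fixes h :: "'b \<Rightarrow> real"
  assumes "finite (set_pmf p)" "\<And>x. x \<in> set_pmf p \<Longrightarrow> finite (set_pmf (q x))"
  shows "measure_pmf.expectation (p \<bind> q) h
    = measure_pmf.expectation p (\<lambda>x. measure_pmf.expectation (q x) h)"
  using assms by (subst pmf_expectation_bind[of "set_pmf p"]) (auto simp: integral_measure_pmf)

lemma expectation_mono_finite:
  fixes h :: "'a \<Rightarrow> real"
  assumes "finite (set_pmf p)" "\<And>x. x \<in> set_pmf p \<Longrightarrow> h x \<le> g x"
  shows "measure_pmf.expectation p h \<le> measure_pmf.expectation p g"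
  using assms by (intro integral_mono_AE integrable_measure_pmf_finite) (auto simp: AE_measure_pmf_iff)

lemma expectation_uniform_return:
  fixes h :: "'b \<Rightarrow> real"
  assumes "k \<ge> 1"
  shows "measure_pmf.expectation (pmf_of_set {..<k} \<bind> (\<lambda>i. return_pmf (g i))) h
    = (\<Sum>i<k. h (g i)) / real k"
  using assms
  by (subst pmf_expectation_bind_pmf_of_set)
    (auto simp: lessThan_empty_iff sum_distrib_left field_simps)

lemma set_pmf_uniform: "k \<ge> 1 \<Longrightarrow> set_pmf (pmf_of_set {..<k}) = {..<k :: nat}"
  by (rule set_pmf_of_set) (auto simp: lessThan_empty_iff)

text \<open>Here \<theta> is any number in (0, 1); its relation to \<kappa> and \<open>m\<close>
  enters only in \<open>round_contraction\<close>.\<close>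

locale svrg_run = sparse_finite_sum +
  fixes m :: nat and \<theta> \<phi> \<eta> :: real and xstar :: "real vec"
  assumes L: "L > 0" and \<theta>: "0 < \<theta>" "\<theta> < 1"
    and \<phi>: "\<phi> = (1 - \<theta>) / L" and \<eta>: "\<eta> = (1 - \<theta>) / (L * \<theta>)"
    and m: "m \<ge> 1" and xstar: "is_minimizer d (avg_fun n F) xstar"
begin

abbreviation "gap x \<equiv> f x - f xstar"
abbreviation "V z \<equiv> (enorm (z - xstar))\<^sup>2"
abbreviation "inner_iter \<equiv> inner_loop d n F T \<theta> \<phi> \<eta>"

lemma xstar_carrier: "xstar \<in> carrier_vec d"
  using xstar by (simp add: is_minimizer_def)

lemma gap_nonneg: "x \<in> carrier_vec d \<Longrightarrow> 0 \<le> gap x"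
  using xstar by (simp add: is_minimizer_def)

lemma \<eta>_pos: "\<eta> > 0"
  using L \<theta> by (simp add: \<eta>)

section \<open>Inner loop and epoch\<close>

lemma inner_loop_support:
  assumes "xt \<in> carrier_vec d" "z0 \<in> carrier_vec d"
  shows "finite (set_pmf (inner_iter xt z0 k)) \<and> (\<forall>(z, ys) \<in> set_pmf (inner_iter xt z0 k).
    z \<in> carrier_vec d \<and> length ys = k \<and> set ys \<subseteq> carrier_vec d)"
proof (induction k)
  case 0
  then show ?case using assms by simp
next
  case (Suc k)
  let ?q = "\<lambda>z ys i. (z - \<eta> \<cdot>\<^sub>v grad_estimator d n F T xt (y_point d n F T \<theta> \<phi> xt z) i,
    ys @ [y_point d n F T \<theta> \<phi> xt z])"
  have set_Suc: "set_pmf (inner_iter xt z0 (Suc k))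
      = (\<Union>s \<in> set_pmf (inner_iter xt z0 k). ?q (fst s) (snd s) ` {..<n})"
    by (simp add: Let_def set_pmf_uniform[OF n] case_prod_unfold UNION_singleton_eq_range)
  have "z \<in> carrier_vec d \<and> length ys = Suc k \<and> set ys \<subseteq> carrier_vec d"
    if zys: "(z, ys) \<in> set_pmf (inner_iter xt z0 (Suc k))" for z ys
  proof -
    obtain s i where s: "s \<in> set_pmf (inner_iter xt z0 k)" and i: "i < n"
      and zy: "(z, ys) = ?q (fst s) (snd s) i"
      using zys unfolding set_Suc by blast
    have "fst s \<in> carrier_vec d" "length (snd s) = k" "set (snd s) \<subseteq> carrier_vec d"
      using Suc.IH s by (auto simp: case_prod_unfold)
    then show ?thesis
      using assms i zy by (simp add: y_point_carrier grad_estimator_carrier)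
  qed
  moreover have "finite (set_pmf (inner_iter xt z0 (Suc k)))"
    unfolding set_Suc using Suc.IH by simp
  ultimately show ?case by blast
qed

text \<open>The potential is a supermartingale: by \<open>coupling_step\<close>, appending
  \<open>y\<close> to the list adds no more than the expected decrease of \<open>V\<close>. The
  weights \<open>w\<close> may be negative, so the whole list is kept in the potential.\<close>

lemma inner_loop_descent:
  assumes xt: "xt \<in> carrier_vec d" and z0: "z0 \<in> carrier_vec d"
  defines "w \<equiv> \<lambda>y. 2 * \<eta> * (gap y + (1 - \<theta>) / \<theta> * (f y - f xt))"
  shows "measure_pmf.expectation (inner_iter xt z0 k) (\<lambda>(z, ys). V z + sum_list (map w ys)) \<le> V z0"
proof (induction k)
  case 0
  then show ?case by simp
next
  case (Suc k)
  let ?H = "\<lambda>(z, ys). V z + sum_list (map w ys)"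
  let ?y = "\<lambda>z. y_point d n F T \<theta> \<phi> xt z"
  let ?q = "\<lambda>(z, ys). pmf_of_set {..<n} \<bind>
    (\<lambda>i. return_pmf (z - \<eta> \<cdot>\<^sub>v grad_estimator d n F T xt (?y z) i, ys @ [?y z]))"
  note sup = inner_loop_support[OF xt z0, of k]
  have "measure_pmf.expectation (inner_iter xt z0 (Suc k)) ?H
      = measure_pmf.expectation (inner_iter xt z0 k \<bind> ?q) ?H"
    by (simp add: Let_def)
  also have "\<dots> = measure_pmf.expectation (inner_iter xt z0 k)
      (\<lambda>s. measure_pmf.expectation (?q s) ?H)"
    using sup n by (intro expectation_bind_finite) (auto simp: set_pmf_uniform)
  also have "\<dots> \<le> measure_pmf.expectation (inner_iter xt z0 k) ?H"
  proof (rule expectation_mono_finite, use sup in simp)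
    fix s assume s: "s \<in> set_pmf (inner_iter xt z0 k)"
    obtain z ys where zy: "s = (z, ys)" by (cases s)
    have z: "z \<in> carrier_vec d" using sup s zy by auto
    have "measure_pmf.expectation (?q s) ?H
        = (\<Sum>i<n. V (z - \<eta> \<cdot>\<^sub>v grad_estimator d n F T xt (?y z) i)
            + (sum_list (map w ys) + w (?y z))) / real n"
      using n by (simp add: zy expectation_uniform_return)
    also have "\<dots> = (\<Sum>i<n. V (z - \<eta> \<cdot>\<^sub>v grad_estimator d n F T xt (?y z) i)) / real n
        + (sum_list (map w ys) + w (?y z))"
      using n by (simp add: sum.distrib add_divide_distrib)
    also have "\<dots> \<le> V z + sum_list (map w ys)"
      using coupling_step[OF L \<theta> \<phi> \<eta> xt z xstar_carrier refl] by (simp add: w_def)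
    finally show "measure_pmf.expectation (?q s) ?H \<le> ?H s" by (simp add: zy)
  qed
  finally show ?case using Suc.IH by simp
qed

lemma epoch_support:
  assumes "xt \<in> carrier_vec d" "z0 \<in> carrier_vec d"
  shows "finite (set_pmf (epoch d n F T m \<theta> \<phi> \<eta> xt z0)) \<and>
    set_pmf (epoch d n F T m \<theta> \<phi> \<eta> xt z0) \<subseteq> carrier_vec d \<times> carrier_vec d"
  using inner_loop_support[OF assms, of m] m
  by (fastforce simp: epoch_def set_pmf_uniform intro: nth_mem)

text \<open>A uniform \<open>t\<close> averages the recorded weights, so the sum in
  \<open>inner_loop_descent\<close>, divided by 2 \<eta> m, becomes the expected weight of the new
  snapshot over 2 \<eta>. The snapshot and the final \<open>z\<close> may be dependent; linearity of
  expectation is enough.\<close>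

lemma epoch_descent:
  assumes xt: "xt \<in> carrier_vec d" and z0: "z0 \<in> carrier_vec d"
  shows "measure_pmf.expectation (epoch d n F T m \<theta> \<phi> \<eta> xt z0)
      (\<lambda>(x, z). gap x / \<theta> + V z / (2 * \<eta> * real m))
    \<le> (1 - \<theta>) / \<theta> * gap xt + V z0 / (2 * \<eta> * real m)"
proof -
  define w where "w = (\<lambda>y. 2 * \<eta> * (gap y + (1 - \<theta>) / \<theta> * (f y - f xt)))"
  let ?H = "\<lambda>(x, z). gap x / \<theta> + V z / (2 * \<eta> * real m)"
  let ?q = "\<lambda>(z, ys). pmf_of_set {..<m} \<bind> (\<lambda>t. return_pmf (ys ! t, z))"
  let ?c = "(1 - \<theta>) / \<theta> * gap xt"
  note sup = inner_loop_support[OF xt z0, of m]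
  have gap_w: "gap y / \<theta> = w y / (2 * \<eta>) + ?c" for y
    using \<theta> \<eta>_pos by (simp add: w_def field_simps)
  have eq: "measure_pmf.expectation (?q s) ?H
      = (\<lambda>(z, ys). V z + sum_list (map w ys)) s / (2 * \<eta> * real m) + ?c"
    if s: "s \<in> set_pmf (inner_iter xt z0 m)" for s
  proof -
    obtain z ys where zy: "s = (z, ys)" by (cases s)
    have len: "length ys = m" using sup s zy by auto
    have "measure_pmf.expectation (?q s) ?H
        = (\<Sum>t<m. w (ys ! t) / (2 * \<eta>) + (?c + V z / (2 * \<eta> * real m))) / real m"
      using m by (simp add: zy expectation_uniform_return gap_w add.assoc)
    also have "\<dots> = (\<Sum>t<m. w (ys ! t)) / (2 * \<eta>) / real m + (?c + V z / (2 * \<eta> * real m))"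
      using m by (simp add: sum.distrib add_divide_distrib sum_divide_distrib)
    finally show ?thesis by (simp add: zy add_divide_distrib sum_list_sum_nth len atLeast0LessThan)
  qed
  have "measure_pmf.expectation (epoch d n F T m \<theta> \<phi> \<eta> xt z0) ?H
      = measure_pmf.expectation (inner_iter xt z0 m) (\<lambda>s. measure_pmf.expectation (?q s) ?H)"
    unfolding epoch_def using sup m
    by (intro expectation_bind_finite) (auto simp: set_pmf_uniform)
  also have "\<dots> = measure_pmf.expectation (inner_iter xt z0 m)
      (\<lambda>s. (\<lambda>(z, ys). V z + sum_list (map w ys)) s / (2 * \<eta> * real m) + ?c)"
    by (rule integral_cong_AE) (auto simp: AE_measure_pmf_iff eq)
  also have "\<dots> = measure_pmf.expectation (inner_iter xt z0 m) (\<lambda>(z, ys). V z + sum_list (map w ys))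
      / (2 * \<eta> * real m) + ?c"
    using sup by (simp add: integrable_measure_pmf_finite)
  also have "\<dots> \<le> V z0 / (2 * \<eta> * real m) + ?c"
    using inner_loop_descent[OF xt z0, of m, folded w_def] \<eta>_pos
    by (intro add_right_mono divide_right_mono) simp_all
  finally show ?thesis by simp
qed

section \<open>Epochs and the averaged snapshot\<close>

lemma epochs_support:
  assumes "x \<in> carrier_vec d"
  shows "finite (set_pmf (epochs d n F T m \<theta> \<phi> \<eta> x s)) \<and>
    set_pmf (epochs d n F T m \<theta> \<phi> \<eta> x s) \<subseteq> carrier_vec d \<times> carrier_vec d \<times> carrier_vec d"
proof (induction s)
  case 0
  then show ?case using assms by simp
next
  case (Suc s)
  have "finite (set_pmf (epoch d n F T m \<theta> \<phi> \<eta> xt z))"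
    "set_pmf (epoch d n F T m \<theta> \<phi> \<eta> xt z) \<subseteq> carrier_vec d \<times> carrier_vec d"
    if "(xt, z, a) \<in> set_pmf (epochs d n F T m \<theta> \<phi> \<eta> x s)" for xt z a
    using epoch_support[of xt z] Suc.IH that by auto
  then show ?case using Suc.IH by fastforce
qed

text \<open>
  Scaling the gap at the running average by \<open>s\<close> makes it subadditive in the snapshots. At \<open>s = 0\<close>
  the factor \<open>s\<close> hides the junk value \<open>1 / 0\<close>.
\<close>

definition avg_gap :: "nat \<Rightarrow> real vec \<Rightarrow> real" where
  "avg_gap s a = real s * gap ((1 / real s) \<cdot>\<^sub>v a)"

text \<open>Convexity with weights s / (s + 1) and 1 / (s + 1), scaled by s + 1. For
  \<open>s = 0\<close> there is no old average, and the empty accumulator makes the new point itself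
  the average.\<close>

lemma avg_gap_Suc:
  assumes a: "a \<in> carrier_vec d" and x: "x \<in> carrier_vec d"
    and zero: "s = 0 \<Longrightarrow> a = 0\<^sub>v d"
  shows "avg_gap (Suc s) (a + x) \<le> avg_gap s a + gap x"
proof (cases "s = 0")
  case True
  then have "(1 / real (Suc s)) \<cdot>\<^sub>v (a + x) = x" using zero x by simp
  then show ?thesis using True by (simp add: avg_gap_def)
next
  case False
  define u v where "u = real s / real (Suc s)" and "v = 1 / real (Suc s)"
  have uv: "0 \<le> u" "0 \<le> v" "u + v = 1" by (auto simp: u_def v_def field_simps)
  have "v = u * (1 / real s)" using False by (simp add: u_def v_def)
  then have "(1 / real (Suc s)) \<cdot>\<^sub>v (a + x) = u \<cdot>\<^sub>v ((1 / real s) \<cdot>\<^sub>v a) + v \<cdot>\<^sub>v x"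
    unfolding v_def[symmetric] smult_smult_assoc
    using a x by (simp add: smult_add_distrib_vec)
  also have "f \<dots> \<le> u * f ((1 / real s) \<cdot>\<^sub>v a) + v * f x"
    using convex_f a x uv unfolding convex_fun_def by simp
  finally have "real (Suc s) * f ((1 / real (Suc s)) \<cdot>\<^sub>v (a + x))
      \<le> real (Suc s) * (u * f ((1 / real s) \<cdot>\<^sub>v a) + v * f x)"
    by (rule mult_left_mono) simp
  also have "\<dots> = (real (Suc s) * u) * f ((1 / real s) \<cdot>\<^sub>v a) + (real (Suc s) * v) * f x"
    by (simp only: distrib_left mult.assoc)
  also have "\<dots> = real s * f ((1 / real s) \<cdot>\<^sub>v a) + f x"
    by (simp add: u_def v_def)
  finally show ?thesis by (simp add: avg_gap_def algebra_simps)
qed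

text \<open>The weight 1 / \<theta> of the new gap in \<open>epoch_descent\<close> splits as 1 + (1
  - \<theta>) / \<theta>. The unit pays for the running average, and the rest is what the next epoch
  charges for its snapshot, so the potential does not grow in expectation.\<close>

lemma epochs_descent:
  assumes x: "x \<in> carrier_vec d"
  shows "measure_pmf.expectation (epochs d n F T m \<theta> \<phi> \<eta> x s)
      (\<lambda>(xt, z, a). avg_gap s a + (1 - \<theta>) / \<theta> * gap xt + V z / (2 * \<eta> * real m))
    \<le> (1 - \<theta>) / \<theta> * gap x + V x / (2 * \<eta> * real m)"
proof (induction s)
  case 0
  then show ?case by (simp add: avg_gap_def)
next
  case (Suc s)
  let ?M = "epochs d n F T m \<theta> \<phi> \<eta> x s"
  let ?H = "\<lambda>s (xt, z, a). avg_gap s a + (1 - \<theta>) / \<theta> * gap xt + V z / (2 * \<eta> * real m)"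
  let ?q = "\<lambda>(xt, z, a). epoch d n F T m \<theta> \<phi> \<eta> xt z \<bind>
    (\<lambda>(xt', z'). return_pmf (xt', z', a + xt'))"
  note sup = epochs_support[OF x, of s]
  have fin: "finite (set_pmf (?q p))" if "p \<in> set_pmf ?M" for p
    using sup that epoch_support by (cases p) fastforce
  have "measure_pmf.expectation (epochs d n F T m \<theta> \<phi> \<eta> x (Suc s)) (?H (Suc s))
      = measure_pmf.expectation ?M (\<lambda>p. measure_pmf.expectation (?q p) (?H (Suc s)))"
    using sup fin by (simp only: epochs.simps) (intro expectation_bind_finite, auto)
  also have "\<dots> \<le> measure_pmf.expectation ?M (?H s)"
  proof (rule expectation_mono_finite, use sup in simp)
    fix p assume p: "p \<in> set_pmf ?M"
    obtain xt z a where pe: "p = (xt, z, a)" by (cases p)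
    have c: "xt \<in> carrier_vec d" "z \<in> carrier_vec d" "a \<in> carrier_vec d"
      using sup p pe by auto
    let ?E = "epoch d n F T m \<theta> \<phi> \<eta> xt z"
    note supE = epoch_support[OF c(1,2)]
    have "measure_pmf.expectation (?q p) (?H (Suc s))
        = measure_pmf.expectation ?E (\<lambda>(xt', z'). ?H (Suc s) (xt', z', a + xt'))"
      using supE by (simp add: pe, subst expectation_bind_finite) (auto simp: case_prod_unfold)
    also have "\<dots> \<le> measure_pmf.expectation ?E
        (\<lambda>r. avg_gap s a + (\<lambda>(xt', z'). gap xt' / \<theta> + V z' / (2 * \<eta> * real m)) r)"
    proof (rule expectation_mono_finite, use supE in simp)
      fix r assume r: "r \<in> set_pmf ?E"
      obtain xt' z' where re: "r = (xt', z')" by (cases r)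
      have "xt' \<in> carrier_vec d" using supE r re by auto
      moreover have "a = 0\<^sub>v d" if "s = 0" using p pe that by simp
      ultimately have "avg_gap (Suc s) (a + xt') \<le> avg_gap s a + gap xt'"
        using c(3) by (intro avg_gap_Suc)
      moreover have "gap xt' + (1 - \<theta>) / \<theta> * gap xt' = gap xt' / \<theta>"
        using \<theta> by (simp add: field_simps)
      ultimately show "(\<lambda>(xt', z'). ?H (Suc s) (xt', z', a + xt')) r
          \<le> avg_gap s a + (\<lambda>(xt', z'). gap xt' / \<theta> + V z' / (2 * \<eta> * real m)) r"
        by (simp add: re)
    qed
    also have "\<dots> = avg_gap s a
        + measure_pmf.expectation ?E (\<lambda>(xt', z'). gap xt' / \<theta> + V z' / (2 * \<eta> * real m))"
      using supE by (simp add: integrable_measure_pmf_finite)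
    also have "\<dots> \<le> ?H s p"
      using epoch_descent[OF c(1,2)] by (simp add: pe)
    finally show "measure_pmf.expectation (?q p) (?H (Suc s)) \<le> ?H s p" .
  qed
  finally show ?case using Suc.IH by simp
qed

section \<open>Restart rounds\<close>

abbreviation "one_round \<equiv> restart_round d n F T m \<theta> \<phi> \<eta>"

lemma round_support:
  assumes "x \<in> carrier_vec d"
  shows "finite (set_pmf (one_round S x)) \<and> set_pmf (one_round S x) \<subseteq> carrier_vec d"
  using epochs_support[OF assms, of S] by (fastforce simp: restart_round_def)

text \<open>The snapshot gap and the distance remaining at the end of the round are nonnegative and
  are discarded.\<close>

lemma round_descent:
  assumes x: "x \<in> carrier_vec d"
  shows "real S * measure_pmf.expectation (one_round S x) gap
    \<le> (1 - \<theta>) / \<theta> * gap x + V x / (2 * \<eta> * real m)"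
proof -
  let ?M = "epochs d n F T m \<theta> \<phi> \<eta> x S"
  note sup = epochs_support[OF x, of S]
  have "measure_pmf.expectation (one_round S x) gap
      = measure_pmf.expectation ?M (\<lambda>(xt, z, a). gap ((1 / real S) \<cdot>\<^sub>v a))"
    unfolding restart_round_def using sup
    by (subst expectation_bind_finite) (auto simp: case_prod_unfold)
  then have "real S * measure_pmf.expectation (one_round S x) gap
      = measure_pmf.expectation ?M (\<lambda>(xt, z, a). avg_gap S a)"
    by (simp add: avg_gap_def case_prod_unfold)
  also have "\<dots> \<le> measure_pmf.expectation ?M
      (\<lambda>(xt, z, a). avg_gap S a + (1 - \<theta>) / \<theta> * gap xt + V z / (2 * \<eta> * real m))"
  proof (rule expectation_mono_finite, use sup in simp)
    fix p assume p: "p \<in> set_pmf ?M"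
    obtain xt z a where pe: "p = (xt, z, a)" by (cases p)
    have "0 \<le> gap xt" using sup p pe by (intro gap_nonneg) auto
    then have "0 \<le> (1 - \<theta>) / \<theta> * gap xt" using \<theta> by simp
    then show "(\<lambda>(xt, z, a). avg_gap S a) p
        \<le> (\<lambda>(xt, z, a). avg_gap S a + (1 - \<theta>) / \<theta> * gap xt + V z / (2 * \<eta> * real m)) p"
      using \<eta>_pos by (simp add: pe)
  qed
  also note epochs_descent[OF x]
  finally show ?thesis .
qed

lemma ss_acc_svrg_contraction:
  assumes x0: "x0 \<in> carrier_vec d" and \<omega>: "\<omega> > 0"
    and contr: "\<And>x. x \<in> carrier_vec d \<Longrightarrow> measure_pmf.expectation (one_round S x) gap \<le> gap x / \<omega>"
  shows "finite (set_pmf (ss_acc_svrg d n F T m \<theta> \<phi> \<eta> S x0 R)) \<and>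
    set_pmf (ss_acc_svrg d n F T m \<theta> \<phi> \<eta> S x0 R) \<subseteq> carrier_vec d \<and>
    measure_pmf.expectation (ss_acc_svrg d n F T m \<theta> \<phi> \<eta> S x0 R) gap \<le> gap x0 / \<omega> ^ R"
proof (induction R)
  case 0
  then show ?case using x0 by simp
next
  case (Suc R)
  let ?M = "ss_acc_svrg d n F T m \<theta> \<phi> \<eta> S x0 R"
  have "measure_pmf.expectation (?M \<bind> one_round S) gap
      = measure_pmf.expectation ?M (\<lambda>x. measure_pmf.expectation (one_round S x) gap)"
    using Suc.IH round_support by (intro expectation_bind_finite) auto
  also have "\<dots> \<le> measure_pmf.expectation ?M (\<lambda>x. gap x / \<omega>)"
    using Suc.IH contr by (intro expectation_mono_finite) auto
  also have "\<dots> = measure_pmf.expectation ?M gap / \<omega>"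
    by (rule integral_divide_zero)
  also have "\<dots> \<le> gap x0 / \<omega> ^ R / \<omega>"
    using Suc.IH \<omega> by (intro divide_right_mono) auto
  finally have "measure_pmf.expectation (?M \<bind> one_round S) gap \<le> gap x0 / \<omega> ^ Suc R"
    by (simp add: mult.commute)
  then show ?case using Suc.IH round_support by auto
qed

text \<open>\<rho> = sqrt (\<kappa> / m) balances the two terms of \<open>round_descent\<close>. The
  first equals \<rho> times the gap. In the second, growth gives V \<le> 2 gap / \<mu>, and \<eta> =
  \<rho> / L turns the bound into \<kappa> / (\<rho> m) = \<rho> times the gap. Their sum is the
  origin of the factor 2 in \<open>S\<close>.\<close>

lemma round_contraction:
  assumes x: "x \<in> carrier_vec d" and \<mu>: "\<mu> > 0" and growth: "quadratic_growth d \<mu> f xstar"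
    and \<rho>: "\<rho> > 0" "(1 - \<theta>) / \<theta> = \<rho>" "L / \<mu> = \<rho>\<^sup>2 * real m"
    and \<omega>: "\<omega> > 0" and S: "2 * \<omega> * \<rho> \<le> real S"
  shows "measure_pmf.expectation (one_round S x) gap \<le> gap x / \<omega>"
proof -
  let ?E = "measure_pmf.expectation (one_round S x) gap"
  have g0: "0 \<le> gap x" by (rule gap_nonneg[OF x])
  have S0: "0 < real S" using S \<rho>(1) \<omega> by (smt (verit) mult_pos_pos)
  have "\<eta> = (1 - \<theta>) / \<theta> / L" by (simp add: \<eta>)
  then have \<eta>\<rho>: "\<eta> = \<rho> / L" by (simp only: \<rho>(2))
  have "\<mu> / 2 * V x \<le> gap x" using growth x by (simp add: quadratic_growth_def)
  then have "V x \<le> 2 * gap x / \<mu>" using \<mu> by (simp add: field_simps)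
  then have "V x / (2 * \<eta> * real m) \<le> 2 * gap x / \<mu> / (2 * \<eta> * real m)"
    using \<eta>_pos by (intro divide_right_mono) auto
  also have "\<dots> = gap x * (L / \<mu>) / (\<rho> * real m)"
    using \<mu> L \<rho>(1) m by (simp add: \<eta>\<rho> field_simps)
  also have "\<dots> = \<rho> * gap x"
    using \<rho>(1) m unfolding \<rho>(3) by (simp add: power2_eq_square)
  finally have "real S * ?E \<le> 2 * \<rho> * gap x"
    using round_descent[OF x, of S] unfolding \<rho>(2) by simp
  also have "\<dots> \<le> real S * (gap x / \<omega>)"
    using mult_right_mono[OF S, of "gap x / \<omega>"] g0 \<omega> by simp
  finally show ?thesis using S0 by (simp only: mult_le_cancel_left_pos)
qed

end

section \<open>Number of rounds and oracle complexity\<close>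

text \<open>Since \<open>\<epsilon> < g\<close> the logarithm is positive and \<open>nat\<close>
  truncates nothing. The lower bound 1 in \<open>log_factor\<close> absorbs the extra round due to
  the ceiling.\<close>

lemma rounds_suffice:
  fixes \<omega> g \<epsilon> :: real
  assumes \<omega>: "\<omega> > 1" and \<epsilon>: "0 < \<epsilon>" and g: "\<epsilon> < g"
  defines "R \<equiv> nat \<lceil>ln (g / \<epsilon>) / ln \<omega>\<rceil>"
  shows "g / \<omega> ^ R \<le> \<epsilon>" "real R \<le> (1 / ln \<omega> + 1) * log_factor g \<epsilon>"
proof -
  have l: "0 < ln \<omega>" using \<omega> by simp
  have q: "0 < ln (g / \<epsilon>)" using g \<epsilon> by simp
  have R: "real R = of_int \<lceil>ln (g / \<epsilon>) / ln \<omega>\<rceil>"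
    using l q by (simp add: R_def)
  have "ln (g / \<epsilon>) / ln \<omega> \<le> real R" unfolding R by simp
  then have "ln (g / \<epsilon>) \<le> real R * ln \<omega>" using l by (simp add: field_simps)
  also have "\<dots> = ln (\<omega> ^ R)" using \<omega> by (simp add: ln_realpow)
  finally have "g / \<epsilon> \<le> \<omega> ^ R" using \<omega> \<epsilon> g by simp
  then show "g / \<omega> ^ R \<le> \<epsilon>" using \<omega> \<epsilon> by (simp add: field_simps)
  have "real R \<le> ln (g / \<epsilon>) / ln \<omega> + 1" unfolding R by linarith
  also have "\<dots> \<le> log_factor g \<epsilon> / ln \<omega> + log_factor g \<epsilon>"
    using l by (intro add_mono divide_right_mono) (auto simp: log_factor_def)
  finally show "real R \<le> (1 / ln \<omega> + 1) * log_factor g \<epsilon>" by (simp add: distrib_right)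
qed

text \<open>With M the maximum in the bound, \<open>S\<close> is at most a constant times M / n: the
  square root becomes sqrt (\<kappa> n) / (sqrt c1 n), and the 1 from the ceiling is at most M / n.
  Each epoch costs at most (1 + 2 c2) n, and n cancels.\<close>

lemma round_cost:
  fixes c1 c2 \<omega> \<kappa> :: real and n m :: nat
  assumes "c1 > 0" "\<omega> > 0" "\<kappa> \<ge> 0" "n \<ge> 1" "c1 * real n \<le> real m" "real m \<le> c2 * real n"
  shows "real (nat \<lceil>2 * \<omega> * sqrt (\<kappa> / real m)\<rceil> * (n + 2 * m))
    \<le> (2 * \<omega> / sqrt c1 + 1) * (1 + 2 * c2) * max (real n) (sqrt (\<kappa> * real n))"
proof -
  let ?S = "nat \<lceil>2 * \<omega> * sqrt (\<kappa> / real m)\<rceil>"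
  let ?M = "max (real n) (sqrt (\<kappa> * real n))"
  have n0: "0 < real n" using assms by simp
  have "0 < c1 * real n" using assms(1) n0 by simp
  moreover from this have "0 < real m" using assms(5) by linarith
  ultimately have "\<kappa> / real m \<le> \<kappa> / (c1 * real n)"
    using assms(3,5) by (intro divide_left_mono) auto
  then have "sqrt (\<kappa> / real m) \<le> sqrt (\<kappa> / (c1 * real n))" by simp
  also have "\<dots> = sqrt (\<kappa> * real n) / sqrt c1 / real n"
  proof -
    have "\<kappa> / (c1 * real n) = \<kappa> * real n / c1 / (real n)\<^sup>2"
      using n0 by (simp add: power2_eq_square)
    then show ?thesis by (simp add: real_sqrt_divide real_sqrt_mult)
  qed
  also have "\<dots> \<le> ?M / sqrt c1 / real n"
    using assms(1) by (intro divide_right_mono) auto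
  finally have "2 * \<omega> * sqrt (\<kappa> / real m) \<le> 2 * \<omega> * (?M / sqrt c1 / real n)"
    using assms(2) by (intro mult_left_mono) auto
  moreover have "1 \<le> ?M / real n" using n0 by (simp add: le_max_iff_disj)
  moreover have "real ?S \<le> 2 * \<omega> * sqrt (\<kappa> / real m) + 1"
  proof -
    have "0 \<le> 2 * \<omega> * sqrt (\<kappa> / real m)" using assms(2,3) by simp
    then show ?thesis by linarith
  qed
  moreover have "2 * \<omega> * (?M / sqrt c1 / real n) + ?M / real n
      = (2 * \<omega> / sqrt c1 + 1) * (?M / real n)"
    by (simp add: distrib_right add_divide_distrib)
  ultimately have "real ?S \<le> (2 * \<omega> / sqrt c1 + 1) * (?M / real n)"
    by linarith
  moreover have "real (n + 2 * m) \<le> (1 + 2 * c2) * real n"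
    using assms(6) by (simp add: distrib_right)
  ultimately have "real ?S * real (n + 2 * m)
      \<le> ((2 * \<omega> / sqrt c1 + 1) * (?M / real n)) * ((1 + 2 * c2) * real n)"
    using assms(1,2) by (intro mult_mono) (auto simp: le_max_iff_disj)
  also have "\<dots> = (2 * \<omega> / sqrt c1 + 1) * (1 + 2 * c2) * ?M"
    using n0 by simp
  finally show ?thesis by simp
qed

theorem theorem1:
  fixes \<omega> c1 c2 :: real
  assumes "\<omega> > 1" and "c1 > 0" and "c2 > 0"
  shows "\<exists>CR>0. \<exists>CO>0.
    \<forall>(d::nat) (n::nat) (m::nat) (F :: nat \<Rightarrow> real vec \<Rightarrow> real) (T :: nat \<Rightarrow> nat set)
      (L::real) (\<mu>::real) (xstar :: real vec) (x0 :: real vec) (\<epsilon>::real).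
      n \<ge> 1 \<and> c1 * real n \<le> real m \<and> real m \<le> c2 * real n \<and>
      (\<forall>i<n. T i \<subseteq> {..<d}) \<and> (\<forall>v<d. \<exists>i<n. v \<in> T i) \<and>
      (\<forall>i<n. convex_fun d (F i) \<and> smooth_fun d L (F i) \<and> supported_on d (T i) (F i)) \<and>
      is_minimizer d (avg_fun n F) xstar \<and>
      \<mu> > 0 \<and> quadratic_growth d \<mu> (avg_fun n F) xstar \<and>
      x0 \<in> carrier_vec d \<and> \<epsilon> > 0 \<longrightarrow>
      (let f = avg_fun n F;
           \<kappa> = L / \<mu>;
           \<theta> = sqrt (real m) / (sqrt \<kappa> + sqrt (real m));
           \<phi> = (1 - \<theta>) / L;
           \<eta> = (1 - \<theta>) / (L * \<theta>);
           S = nat \<lceil>2 * \<omega> * sqrt (\<kappa> / real m)\<rceil>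
       in \<exists>R::nat.
            real R \<le> CR * log_factor (f x0 - f xstar) \<epsilon> \<and>
            measure_pmf.expectation (ss_acc_svrg d n F T m \<theta> \<phi> \<eta> S x0 R) f - f xstar \<le> \<epsilon> \<and>
            real (oracle_complexity n m S R)
              \<le> CO * max (real n) (sqrt (\<kappa> * real n)) * log_factor (f x0 - f xstar) \<epsilon>)"
proof -
  \<comment> \<open>\<open>CR\<close> counts rounds per unit of \<open>log_factor\<close>, and
    \<open>K\<close> bounds the cost of one round relative to the maximum; hence the oracle constant
    \<open>CR * K\<close>.\<close>
  define CR where "CR = 1 / ln \<omega> + 1"
  define K where "K = (2 * \<omega> / sqrt c1 + 1) * (1 + 2 * c2)"
  have CR: "CR > 0" using assms by (simp add: CR_def add_pos_pos)
  have K: "K > 0" using assms by (simp add: K_def add_pos_pos)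
  show ?thesis
  proof (rule exI[of _ CR], rule conjI[OF CR], rule exI[of _ "CR * K"], rule conjI,
      use CR K in simp, intro allI impI, elim conjE)
    fix d n m :: nat and F :: "nat \<Rightarrow> real vec \<Rightarrow> real" and T :: "nat \<Rightarrow> nat set"
      and L \<mu> :: real and xstar x0 :: "real vec" and \<epsilon> :: real
    assume n: "n \<ge> 1" and mn: "c1 * real n \<le> real m" "real m \<le> c2 * real n"
      and T: "\<forall>i<n. T i \<subseteq> {..<d}" and cover: "\<forall>v<d. \<exists>i<n. v \<in> T i"
      and F: "\<forall>i<n. convex_fun d (F i) \<and> smooth_fun d L (F i) \<and> supported_on d (T i) (F i)"
      and xstar: "is_minimizer d (avg_fun n F) xstar"
      and \<mu>: "\<mu> > 0" and growth: "quadratic_growth d \<mu> (avg_fun n F) xstar"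
      and x0: "x0 \<in> carrier_vec d" and \<epsilon>: "\<epsilon> > 0"
    interpret sparse_finite_sum d n F T L
      using n T cover F by unfold_locales auto
    define \<kappa> where "\<kappa> = L / \<mu>"
    define \<theta> where "\<theta> = sqrt (real m) / (sqrt \<kappa> + sqrt (real m))"
    define \<phi> where "\<phi> = (1 - \<theta>) / L"
    define \<eta> where "\<eta> = (1 - \<theta>) / (L * \<theta>)"
    define S where "S = nat \<lceil>2 * \<omega> * sqrt (\<kappa> / real m)\<rceil>"
    define g where "g = f x0 - f xstar"
    let ?M = "max (real n) (sqrt (\<kappa> * real n))"
    have lf: "log_factor g \<epsilon> \<ge> 1" by (simp add: log_factor_def)
    have "\<exists>R. real R \<le> CR * log_factor g \<epsilon> \<and>
      measure_pmf.expectation (ss_acc_svrg d n F T m \<theta> \<phi> \<eta> S x0 R) f - f xstar \<le> \<epsilon> \<and>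
      real (oracle_complexity n m S R) \<le> CR * K * ?M * log_factor g \<epsilon>"
    proof (cases "g \<le> \<epsilon>")
      case True
      \<comment> \<open>The initial point is accurate enough, so \<open>R = 0\<close>. The maximum
        is nonnegative because of \<open>real n\<close>, even if \<kappa> is negative.\<close>
      have "0 \<le> ?M" by simp
      then show ?thesis
        using True CR K lf
        by (intro exI[of _ 0]) (auto simp: oracle_complexity_def g_def)
    next
      case False
      then have g: "\<epsilon> < g" by simp
      have xc: "xstar \<in> carrier_vec d" using xstar by (simp add: is_minimizer_def)
      \<comment> \<open>In dimension 0 there is a single point, so the gap would be 0 and could not
        exceed \<epsilon>.\<close>
      have d: "d \<ge> 1"
      proof (rule ccontr)
        assume "\<not> d \<ge> 1"
        then have "x0 = xstar" using x0 xc by (intro eq_vecI) auto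
        then show False using g \<epsilon> by (simp add: g_def)
      qed
      have "\<mu> \<le> L" by (rule growth_le_smoothness[OF d xc growth])
      then have L: "L > 0" using \<mu> by simp
      have "0 < c1 * real n" using n assms(2) by simp
      then have m0: "0 < real m" using mn(1) by linarith
      have \<kappa>: "\<kappa> > 0" using L \<mu> by (simp add: \<kappa>_def)
      have sq: "0 < sqrt \<kappa>" "0 < sqrt (real m)" using \<kappa> m0 by auto
      have sum: "0 < sqrt \<kappa> + sqrt (real m)" using sq by linarith
      have \<theta>: "0 < \<theta>" "\<theta> < 1"
        unfolding \<theta>_def using sq sum by (simp_all only: divide_pos_pos divide_less_eq_1_pos)
      define \<rho> where "\<rho> = sqrt (\<kappa> / real m)"
      have \<rho>: "\<rho> > 0" "(1 - \<theta>) / \<theta> = \<rho>" "L / \<mu> = \<rho>\<^sup>2 * real m"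
      proof -
        show "\<rho> > 0" using \<kappa> m0 by (simp add: \<rho>_def)
        have "(1 - b / (a + b)) / (b / (a + b)) = a / b" if "0 < a" "0 < b" for a b :: real
        proof -
          have "a + b \<noteq> 0" using that by simp
          then have "1 - b / (a + b) = a / (a + b)" by (simp add: field_simps)
          then show ?thesis using \<open>a + b \<noteq> 0\<close> by simp
        qed
        from this[OF sq] have "(1 - \<theta>) / \<theta> = sqrt \<kappa> / sqrt (real m)"
          unfolding \<theta>_def .
        then show "(1 - \<theta>) / \<theta> = \<rho>"
          by (simp only: \<rho>_def real_sqrt_divide)
        show "L / \<mu> = \<rho>\<^sup>2 * real m"
          using \<kappa> m0 by (simp add: \<rho>_def flip: \<kappa>_def)
      qed
      interpret svrg_run d n F T L m \<theta> \<phi> \<eta> xstar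
        using L \<theta> m0 xstar by unfold_locales (auto simp: \<phi>_def \<eta>_def)
      have S: "2 * \<omega> * \<rho> \<le> real S" unfolding S_def \<rho>_def by linarith
      define R where "R = nat \<lceil>ln (g / \<epsilon>) / ln \<omega>\<rceil>"
      note R = rounds_suffice[OF assms(1) \<epsilon> g, folded R_def CR_def]
      let ?A = "ss_acc_svrg d n F T m \<theta> \<phi> \<eta> S x0 R"
      have run: "finite (set_pmf ?A) \<and> set_pmf ?A \<subseteq> carrier_vec d \<and>
          measure_pmf.expectation ?A gap \<le> gap x0 / \<omega> ^ R"
        using assms(1) by (intro ss_acc_svrg_contraction x0 round_contraction[OF _ \<mu> growth \<rho> _ S]) auto
      then have "measure_pmf.expectation ?A gap = measure_pmf.expectation ?A f - f xstar"
        by (subst Bochner_Integration.integral_diff) (auto intro: integrable_measure_pmf_finite)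
      with run have "measure_pmf.expectation ?A f - f xstar \<le> g / \<omega> ^ R"
        by (simp add: g_def)
      moreover have "real (oracle_complexity n m S R) \<le> CR * K * ?M * log_factor g \<epsilon>"
      proof -
        have "real (oracle_complexity n m S R) = real R * real (S * (n + 2 * m))"
          by (simp add: oracle_complexity_def algebra_simps)
        also have "\<dots> \<le> (CR * log_factor g \<epsilon>) * (K * ?M)"
        proof (rule mult_mono[OF R(2)])
          show "real (S * (n + 2 * m)) \<le> K * ?M"
            unfolding S_def K_def by (rule round_cost) (use assms \<kappa> n mn in auto)
          show "0 \<le> CR * log_factor g \<epsilon>" using CR lf by simp
        qed (rule of_nat_0_le_iff)
        finally show ?thesis by (simp add: mult_ac)
      qed
      ultimately show ?thesis using R by (intro exI[of _ R]) linarith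
    qed
    then show "let f = avg_fun n F;
           \<kappa> = L / \<mu>;
           \<theta> = sqrt (real m) / (sqrt \<kappa> + sqrt (real m));
           \<phi> = (1 - \<theta>) / L;
           \<eta> = (1 - \<theta>) / (L * \<theta>);
           S = nat \<lceil>2 * \<omega> * sqrt (\<kappa> / real m)\<rceil>
       in \<exists>R::nat.
            real R \<le> CR * log_factor (f x0 - f xstar) \<epsilon> \<and>
            measure_pmf.expectation (ss_acc_svrg d n F T m \<theta> \<phi> \<eta> S x0 R) f - f xstar \<le> \<epsilon> \<and>
            real (oracle_complexity n m S R)
              \<le> CR * K * max (real n) (sqrt (\<kappa> * real n)) * log_factor (f x0 - f xstar) \<epsilon>"
      unfolding Let_def \<kappa>_def \<theta>_def \<phi>_def \<eta>_def S_def g_def .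
  qed
qed

end
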